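(* Let $(\mathcal{M},g)$ be a smooth Riemannian manifold with Levi-Civita connection $D$ and curvature tensor $R$, and let $\varepsilon$ be a random function on $\mathcal{M}$ that is almost surely $C^2$. For every smooth vector field $X$ put $\widetilde X=\varepsilon X$. Let $\widetilde R(X,Y)Z=R(\widetilde X,\widetilde Y)\widetilde Z$ be the stochastic curvature tensor and $\widetilde{\mathcal{R}}(X,Y,Z,W)=\langle R(\widetilde Z,\widetilde W)\widetilde X,\widetilde Y\rangle$ the stochastic Riemannian curvature tensor. Then, almost surely, for all smooth vector fields $X,Y,Z,W$ on $\mathcal{M}$: 1. (Skew symmetry) $\widetilde{\mathcal{R}}(X,Y,Z,W)=-\widetilde{\mathcal{R}}(Y,X,Z,W)=-\widetilde{\mathcal{R}}(X,Y,W,Z)$. 2. (Exchange symmetry) $\widetilde{\mathcal{R}}(X,Y,Z,W)=\widetilde{\mathcal{R}}(Z,W,X,Y)$. 3. (First Bianchi identity) $\widetilde{\mathcal{R}}(X,Y,Z,W)+\widetilde{\mathcal{R}}(Z,Y,W,X)+\widetilde{\mathcal{R}}(W,Y,X,Z)=0$. 4. (Second Bianchi identity) $$(D_{\widetilde X}\widetilde R)(Y,Z)+(D_{\widetilde Y}\widetilde R)(Z,X)+(D_{\widetilde Z}\widetilde R)(X,Y)=3\varepsilon^3\big(X(\varepsilon)R(Y,Z)+Y(\varepsilon)R(Z,X)+Z(\varepsilon)R(X,Y)\big).$$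
   Context: $\langle X,Y\rangle=g(X,Y)$. The curvature tensor of $D$ is $R(X,Y)Z=D_XD_YZ-D_YD_XZ-D_{[X,Y]}Z$. For a vector field $V$ and a function $f$, $V(f)$ is the derivative of $f$ along $V$. In item 4, $\widetilde R$ is regarded as the (random) $(1,3)$-tensor field $(X,Y,Z)\mapsto\widetilde R(X,Y)Z=R(\varepsilon X,\varepsilon Y)(\varepsilon Z)$, $D_{\widetilde X}\widetilde R$ is its covariant derivative as a tensor field in the direction $\widetilde X=\varepsilon X$, and both sides are endomorphism fields of the tangent bundle, i.e. the identity holds after applying both sides to an arbitrary vector field. *)

theory Defs
  imports "HOL-Probability.Probability" "HOL-Library.Function_Algebras"
begin

text \<open>For open \<open>S\<close> this is the usual class C^k: all iterated directional derivatives up to order \<open>k\<close>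
  exist and are continuous. Only open \<open>S\<close> occur below.\<close>

primrec Ck_on :: "nat \<Rightarrow> 'e::euclidean_space set \<Rightarrow> ('e \<Rightarrow> 'f::real_normed_vector) \<Rightarrow> bool" where
  "Ck_on 0 S f \<longleftrightarrow> continuous_on S f"
| "Ck_on (Suc k) S f \<longleftrightarrow>
     (\<forall>x\<in>S. f differentiable (at x)) \<and> (\<forall>v. Ck_on k S (\<lambda>x. frechet_derivative f (at x) v))"

text \<open>A chart is a pair of its domain and its coordinate map; the values of the coordinate map
  outside the domain are irrelevant.\<close>

type_synonym ('a, 'e) chart = "'a set \<times> ('a \<Rightarrow> 'e)"

definition chart_inv :: "('a, 'e) chart \<Rightarrow> 'e \<Rightarrow> 'a" where
  "chart_inv c = inv_into (fst c) (snd c)"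

definition transition :: "('a, 'e) chart \<Rightarrow> ('a, 'e) chart \<Rightarrow> 'e \<Rightarrow> 'e" where
  "transition c d = snd d \<circ> chart_inv c"

locale smooth_manifold =
  fixes T :: "'a topology" and A :: "('a, 'e::euclidean_space) chart set"
  assumes Hausdorff: "Hausdorff_space T"
    and second_countable: "second_countable T"
    and chart_domain_open: "c \<in> A \<Longrightarrow> openin T (fst c)"
    and chart_image_open: "c \<in> A \<Longrightarrow> open (snd c ` fst c)"
    and chart_homeomorphic:
      "c \<in> A \<Longrightarrow> homeomorphic_map (subtopology T (fst c)) (top_of_set (snd c ` fst c)) (snd c)"
    and charts_cover: "(\<Union>c\<in>A. fst c) = topspace T"
    and charts_compatible:
      "\<lbrakk>c \<in> A; d \<in> A\<rbrakk> \<Longrightarrow> Ck_on k (snd c ` (fst c \<inter> fst d)) (transition c d)"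

text \<open>A tangent vector at \<open>p\<close> is the family of its coordinate representations in all charts
  around \<open>p\<close>; these are related by the derivatives of the transition maps. (Derivations of the
  algebra of smooth functions would not act on functions that are only C^1 or C^2.) The value \<open>0\<close>
  at irrelevant indices makes tangent vectors, and hence vector fields, extensional; in particular a
  vector field vanishes outside the manifold.\<close>

type_synonym ('a, 'e) tangent = "('a, 'e) chart \<Rightarrow> 'e"
type_synonym ('a, 'e) vfield = "'a \<Rightarrow> ('a, 'e) tangent"

definition tangent_space ::
    "('a, 'e::euclidean_space) chart set \<Rightarrow> 'a \<Rightarrow> ('a, 'e) tangent set" where
  "tangent_space A p =
     {v. (\<forall>c\<in>A. \<forall>d\<in>A. p \<in> fst c \<inter> fst d \<longrightarrow>
            v d = frechet_derivative (transition c d) (at (snd c p)) (v c)) \<and>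
         (\<forall>c. c \<notin> A \<or> p \<notin> fst c \<longrightarrow> v c = 0)}"

definition Ck_function ::
    "('a, 'e::euclidean_space) chart set \<Rightarrow> nat \<Rightarrow> ('a \<Rightarrow> real) \<Rightarrow> bool" where
  "Ck_function A k f \<longleftrightarrow> (\<forall>c\<in>A. Ck_on k (snd c ` fst c) (\<lambda>x. f (chart_inv c x)))"

definition Ck_vfield ::
    "('a, 'e::euclidean_space) chart set \<Rightarrow> nat \<Rightarrow> ('a, 'e) vfield \<Rightarrow> bool" where
  "Ck_vfield A k X \<longleftrightarrow> (\<forall>p. X p \<in> tangent_space A p) \<and>
     (\<forall>c\<in>A. Ck_on k (snd c ` fst c) (\<lambda>x. X (chart_inv c x) c))"

definition smooth_function :: "('a, 'e::euclidean_space) chart set \<Rightarrow> ('a \<Rightarrow> real) \<Rightarrow> bool" where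
  "smooth_function A f \<longleftrightarrow> (\<forall>k. Ck_function A k f)"

definition smooth_vfield ::
    "('a, 'e::euclidean_space) chart set \<Rightarrow> ('a, 'e) vfield \<Rightarrow> bool" where
  "smooth_vfield A X \<longleftrightarrow> (\<forall>k. Ck_vfield A k X)"

text \<open>Sums and differences of vector fields are pointwise (Function_Algebras).\<close>

definition fscale :: "('a \<Rightarrow> real) \<Rightarrow> ('a, 'e::real_vector) vfield \<Rightarrow> ('a, 'e) vfield"
    (infixr "\<odot>" 75) where
  "f \<odot> X = (\<lambda>p c. f p *\<^sub>R X p c)"

text \<open>The derivative \<open>V(f)\<close> is computed in an arbitrary chart around \<open>p\<close>; for a vector field \<open>V\<close> and
  a C^1 function \<open>f\<close> the chain rule makes the result independent of the chart.\<close>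

definition vderiv ::
    "('a, 'e::euclidean_space) chart set \<Rightarrow> ('a, 'e) vfield \<Rightarrow> ('a \<Rightarrow> real) \<Rightarrow> 'a \<Rightarrow> real" where
  "vderiv A V f p =
     (let c = (SOME c. c \<in> A \<and> p \<in> fst c)
      in frechet_derivative (\<lambda>x. f (chart_inv c x)) (at (snd c p)) (V p c))"

text \<open>In coordinates, the \<open>i\<close>-th component of \<open>[X, Y]\<close> is the sum over \<open>j\<close> of
  \<open>X\<^sub>j \<partial>\<^sub>j Y\<^sub>i - Y\<^sub>j \<partial>\<^sub>j X\<^sub>i\<close>, so that \<open>[X, Y](f) = X(Y(f)) - Y(X(f))\<close>.\<close>

definition lie_bracket ::
    "('a, 'e::euclidean_space) chart set \<Rightarrow> ('a, 'e) vfield \<Rightarrow> ('a, 'e) vfield \<Rightarrow> ('a, 'e) vfield" where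
  "lie_bracket A X Y = (\<lambda>p c.
     if c \<in> A \<and> p \<in> fst c
     then frechet_derivative (\<lambda>x. Y (chart_inv c x) c) (at (snd c p)) (X p c)
        - frechet_derivative (\<lambda>x. X (chart_inv c x) c) (at (snd c p)) (Y p c)
     else 0)"

locale riemannian_manifold = smooth_manifold T A
  for T :: "'a topology" and A :: "('a, 'e::euclidean_space) chart set" +
  fixes g :: "'a \<Rightarrow> ('a, 'e) tangent \<Rightarrow> ('a, 'e) tangent \<Rightarrow> real"
  assumes metric_add:
      "\<lbrakk>p \<in> topspace T; u \<in> tangent_space A p; v \<in> tangent_space A p; w \<in> tangent_space A p\<rbrakk>
        \<Longrightarrow> g p (u + v) w = g p u w + g p v w"
    and metric_scale:
      "\<lbrakk>p \<in> topspace T; u \<in> tangent_space A p; v \<in> tangent_space A p\<rbrakk>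
        \<Longrightarrow> g p (\<lambda>c. a *\<^sub>R u c) v = a * g p u v"
    and metric_sym:
      "\<lbrakk>p \<in> topspace T; u \<in> tangent_space A p; v \<in> tangent_space A p\<rbrakk> \<Longrightarrow> g p u v = g p v u"
    and metric_pos:
      "\<lbrakk>p \<in> topspace T; u \<in> tangent_space A p; u \<noteq> 0\<rbrakk> \<Longrightarrow> 0 < g p u u"
    and metric_smooth:
      "\<lbrakk>smooth_vfield A X; smooth_vfield A Y\<rbrakk> \<Longrightarrow> smooth_function A (\<lambda>p. g p (X p) (Y p))"

text \<open>\<open>D X Y\<close> is the covariant derivative of \<open>Y\<close> along \<open>X\<close>. A connection on the smooth vector
  fields is local and tensorial in \<open>X\<close> and hence has exactly one extension to fields of finite
  differentiability that still satisfies the Leibniz rule, given in each chart by the usual formula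
  with Christoffel symbols. The operator below is this extension: it is needed because \<open>\<epsilon> \<odot> X\<close> is
  only C^2 for a C^2 function \<open>\<epsilon>\<close>. The values of \<open>D X Y\<close> are unconstrained unless \<open>X\<close> is a continuous
  and \<open>Y\<close> a C^1 vector field.\<close>

locale linear_connection = smooth_manifold T A
  for T :: "'a topology" and A :: "('a, 'e::euclidean_space) chart set" +
  fixes D :: "('a, 'e) vfield \<Rightarrow> ('a, 'e) vfield \<Rightarrow> ('a, 'e) vfield"
  assumes connection_Ck:
      "\<lbrakk>Ck_vfield A k X; Ck_vfield A (Suc k) Y\<rbrakk> \<Longrightarrow> Ck_vfield A k (D X Y)"
    and connection_add_left:
      "\<lbrakk>Ck_vfield A 0 X; Ck_vfield A 0 X'; Ck_vfield A 1 Y\<rbrakk> \<Longrightarrow> D (X + X') Y = D X Y + D X' Y"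
    and connection_scale_left:
      "\<lbrakk>Ck_function A 0 f; Ck_vfield A 0 X; Ck_vfield A 1 Y\<rbrakk> \<Longrightarrow> D (f \<odot> X) Y = f \<odot> D X Y"
    and connection_add_right:
      "\<lbrakk>Ck_vfield A 0 X; Ck_vfield A 1 Y; Ck_vfield A 1 Y'\<rbrakk> \<Longrightarrow> D X (Y + Y') = D X Y + D X Y'"
    and connection_Leibniz:
      "\<lbrakk>Ck_function A 1 f; Ck_vfield A 0 X; Ck_vfield A 1 Y\<rbrakk>
        \<Longrightarrow> D X (f \<odot> Y) = vderiv A X f \<odot> Y + f \<odot> D X Y"

locale levi_civita_connection = riemannian_manifold T A g + linear_connection T A D
  for T :: "'a topology" and A :: "('a, 'e::euclidean_space) chart set"
    and g :: "'a \<Rightarrow> ('a, 'e) tangent \<Rightarrow> ('a, 'e) tangent \<Rightarrow> real"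
    and D :: "('a, 'e) vfield \<Rightarrow> ('a, 'e) vfield \<Rightarrow> ('a, 'e) vfield" +
  assumes torsion_free:
      "\<lbrakk>smooth_vfield A X; smooth_vfield A Y\<rbrakk> \<Longrightarrow> D X Y - D Y X = lie_bracket A X Y"
    and metric_compatible:
      "\<lbrakk>smooth_vfield A X; smooth_vfield A Y; smooth_vfield A Z; p \<in> topspace T\<rbrakk>
        \<Longrightarrow> vderiv A X (\<lambda>q. g q (Y q) (Z q)) p = g p (D X Y p) (Z p) + g p (Y p) (D X Z p)"

definition curvature ::
    "('a, 'e::euclidean_space) chart set \<Rightarrow> (('a, 'e) vfield \<Rightarrow> ('a, 'e) vfield \<Rightarrow> ('a, 'e) vfield)
      \<Rightarrow> ('a, 'e) vfield \<Rightarrow> ('a, 'e) vfield \<Rightarrow> ('a, 'e) vfield \<Rightarrow> ('a, 'e) vfield" where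
  "curvature A D X Y Z = D X (D Y Z) - D Y (D X Z) - D (lie_bracket A X Y) Z"

definition stochastic_curvature ::
    "('a, 'e::euclidean_space) chart set \<Rightarrow> (('a, 'e) vfield \<Rightarrow> ('a, 'e) vfield \<Rightarrow> ('a, 'e) vfield)
      \<Rightarrow> ('a \<Rightarrow> real) \<Rightarrow> ('a, 'e) vfield \<Rightarrow> ('a, 'e) vfield \<Rightarrow> ('a, 'e) vfield \<Rightarrow> ('a, 'e) vfield" where
  "stochastic_curvature A D \<epsilon> X Y Z = curvature A D (\<epsilon> \<odot> X) (\<epsilon> \<odot> Y) (\<epsilon> \<odot> Z)"

definition stochastic_riemann ::
    "('a, 'e::euclidean_space) chart set \<Rightarrow> ('a \<Rightarrow> ('a, 'e) tangent \<Rightarrow> ('a, 'e) tangent \<Rightarrow> real)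
      \<Rightarrow> (('a, 'e) vfield \<Rightarrow> ('a, 'e) vfield \<Rightarrow> ('a, 'e) vfield) \<Rightarrow> ('a \<Rightarrow> real)
      \<Rightarrow> ('a, 'e) vfield \<Rightarrow> ('a, 'e) vfield \<Rightarrow> ('a, 'e) vfield \<Rightarrow> ('a, 'e) vfield \<Rightarrow> 'a \<Rightarrow> real" where
  "stochastic_riemann A g D \<epsilon> X Y Z W p =
     g p (curvature A D (\<epsilon> \<odot> Z) (\<epsilon> \<odot> W) (\<epsilon> \<odot> X) p) ((\<epsilon> \<odot> Y) p)"

text \<open>\<open>tensor_cov_deriv D S X Y Z W\<close> is \<open>(D\<^sub>X S)(Y, Z) W\<close> for a (1,3)-tensor field \<open>S\<close>.\<close>

definition tensor_cov_deriv ::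
    "(('a, 'e::euclidean_space) vfield \<Rightarrow> ('a, 'e) vfield \<Rightarrow> ('a, 'e) vfield)
      \<Rightarrow> (('a, 'e) vfield \<Rightarrow> ('a, 'e) vfield \<Rightarrow> ('a, 'e) vfield \<Rightarrow> ('a, 'e) vfield)
      \<Rightarrow> ('a, 'e) vfield \<Rightarrow> ('a, 'e) vfield \<Rightarrow> ('a, 'e) vfield \<Rightarrow> ('a, 'e) vfield \<Rightarrow> ('a, 'e) vfield" where
  "tensor_cov_deriv D S X Y Z W =
     D X (S Y Z W) - S (D X Y) Z W - S Y (D X Z) W - S Y Z (D X W)"

end

theory Submission
  imports Defs
begin

text \<open>Everything rests on the tensoriality of the curvature,
  \<open>R(f X, h Y)(k Z) = f h k R(X, Y) Z\<close>, for smooth \<open>X\<close>, \<open>Y\<close>, \<open>Z\<close> and functions of class C^2. With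
  all factors equal to \<open>\<epsilon>\<close> it gives \<open>\<epsilon>\<^sup>3 R\<close> for the stochastic curvature and \<open>\<epsilon>\<^sup>4 \<langle>R(Z, W) X, Y\<rangle>\<close> for
  the stochastic Riemann tensor, at every sample point at which \<open>\<epsilon>\<close> is C^2. Hence the first three
  items are the classical symmetries of \<open>R\<close>, multiplied by \<open>\<epsilon>\<^sup>4\<close>. In the fourth, the Leibniz rule gives
  \<open>(D\<^bsub>\<epsilon>X\<^esub> \<epsilon>\<^sup>3 R)(Y, Z) = \<epsilon>\<^sup>4 (D\<^bsub>X\<^esub> R)(Y, Z) + 3 \<epsilon>\<^sup>3 X(\<epsilon>) R(Y, Z)\<close>; the classical second Bianchi identity
  removes the first terms from the cyclic sum and leaves the second ones.

  Tensoriality (\<open>curvature_fscale\<close>) cannot be taken from the theory of smooth fields because \<open>\<epsilon> X\<close> is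
  only C^2. It is derived from the rules for the connection and two facts about brackets: the product
  rule for \<open>[f X, h Y]\<close> (\<open>lie_bracket_fscale\<close>) and \<open>X(Y(f)) - Y(X(f)) = [X, Y](f)\<close>
  (\<open>vderiv_commutator\<close>). The classical identities need the latter again, for the skew symmetry of
  \<open>\<langle>R(X, Y) Z, W\<rangle>\<close> in \<open>Z\<close> and \<open>W\<close>, and the Jacobi identity (\<open>lie_bracket_Jacobi\<close>), for both Bianchi
  identities.

  The commutator formula and the Jacobi identity are proved in a chart. There both are the
  statement that the commutator of the derivatives along two vector fields is the derivative along
  their bracket, applied to real-valued functions for the former and to vector-valued ones for the
  latter; this is the symmetry of second derivatives (\<open>second_derivative_symmetric\<close>).

  No change of coordinates is ever applied to a Lie bracket: that the bracket of smooth fields is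
  again a smooth field follows from the vanishing torsion, since \<open>D X Y - D Y X\<close> is one.\<close>

section \<open>Closure properties of functions of class C^k on an open set\<close>

lemma Ck_on_differentiable:
  "Ck_on (Suc k) S f \<Longrightarrow> x \<in> S \<Longrightarrow> f differentiable (at x)"
  by simp

lemma Ck_on_has_derivative:
  "Ck_on (Suc k) S f \<Longrightarrow> x \<in> S \<Longrightarrow> (f has_derivative frechet_derivative f (at x)) (at x)"
  by (simp add: frechet_derivative_works)

lemma Ck_on_frechet_derivative:
  "Ck_on (Suc k) S f \<Longrightarrow> Ck_on k S (\<lambda>x. frechet_derivative f (at x) v)"
  by simp

lemma frechet_derivative_eqI:
  "(f has_derivative f') (at x) \<Longrightarrow> frechet_derivative f (at x) = f'"
  using frechet_derivative_at by metis

text \<open>The operator is a choice among the derivatives, and the two functions have the same ones; this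
  covers points at which neither of them is differentiable.\<close>

lemma frechet_derivative_cong_open:
  assumes "open S" "x \<in> S" "\<And>z. z \<in> S \<Longrightarrow> f z = g z"
  shows "frechet_derivative f (at x) = frechet_derivative g (at x)"
proof -
  have "(f has_derivative f') (at x) \<longleftrightarrow> (g has_derivative f') (at x)" for f'
    by (rule iffI; erule has_derivative_transform_within_open[OF _ assms(1,2)]) (simp_all add: assms(3))
  then show ?thesis
    by (simp add: frechet_derivative_def)
qed

text \<open>The definition of C^k refers to derivatives at the points of \<open>S\<close> only, and these see nothing
  outside the open set \<open>S\<close>.\<close>

lemma Ck_on_cong:
  assumes "open S" "\<And>x. x \<in> S \<Longrightarrow> f x = g x"
  shows "Ck_on k S f \<longleftrightarrow> Ck_on k S g"
  using assms
proof (induction k arbitrary: f g)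
  case 0
  then show ?case by (simp cong: continuous_on_cong)
next
  case (Suc k)
  have "f differentiable (at x) \<longleftrightarrow> g differentiable (at x)" if "x \<in> S" for x
    unfolding differentiable_def
    by (rule iffI; elim exE, rule exI, erule has_derivative_transform_within_open[OF _ Suc.prems(1) that])
      (simp_all add: Suc.prems(2))
  moreover have "Ck_on k S (\<lambda>x. frechet_derivative f (at x) v) \<longleftrightarrow>
      Ck_on k S (\<lambda>x. frechet_derivative g (at x) v)" for v
    by (rule Suc.IH[OF Suc.prems(1)], subst frechet_derivative_cong_open[OF Suc.prems(1) _ Suc.prems(2)]) simp_all
  ultimately show ?case by simp
qed

lemma Ck_on_lower: "Ck_on (Suc k) S f \<Longrightarrow> Ck_on k S f"
proof (induction k arbitrary: f)
  case 0
  then show ?case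
    by (simp add: differentiable_imp_continuous_on differentiable_on_def differentiable_at_withinI)
next
  case (Suc k)
  then show ?case by (metis Ck_on.simps(2))
qed

lemma Ck_on_mono: "Ck_on k S f \<Longrightarrow> j \<le> k \<Longrightarrow> Ck_on j S f"
  by (induction k) (auto simp: le_Suc_eq simp del: Ck_on.simps dest: Ck_on_lower)

lemma Ck_on_const: "Ck_on k S (\<lambda>x. c)"
  by (induction k arbitrary: c) auto

lemma Ck_on_add:
  assumes "open S" "Ck_on k S f" "Ck_on k S g"
  shows "Ck_on k S (\<lambda>x. f x + g x)"
  using assms
proof (induction k arbitrary: f g)
  case 0
  then show ?case by (simp add: continuous_on_add)
next
  case (Suc k)
  have "frechet_derivative (\<lambda>x. f x + g x) (at x) =
      (\<lambda>v. frechet_derivative f (at x) v + frechet_derivative g (at x) v)" if "x \<in> S" for x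
    using Suc.prems that
    by (intro frechet_derivative_eqI has_derivative_add Ck_on_has_derivative)
  then have "Ck_on k S (\<lambda>x. frechet_derivative (\<lambda>x. f x + g x) (at x) v)" for v
    by (subst Ck_on_cong[OF Suc.prems(1)]) (use Suc in auto)
  then show ?case
    using Suc.prems by (auto intro: differentiable_add)
qed

lemma Ck_on_sum:
  assumes "open S" "finite I" "\<And>i. i \<in> I \<Longrightarrow> Ck_on k S (f i)"
  shows "Ck_on k S (\<lambda>x. \<Sum>i\<in>I. f i x)"
  using assms(2,3) by (induction I) (auto intro: Ck_on_const Ck_on_add assms(1))

text \<open>The product rule writes the derivative as a sum of two products of the same kind, so the class
  of bilinear products is closed under the induction on \<open>k\<close>; scalar multiples, products of functions
  and inner products are covered alike.\<close>

lemma Ck_on_bilinear: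
  assumes "bounded_bilinear pr" "open S" "Ck_on k S f" "Ck_on k S g"
  shows "Ck_on k S (\<lambda>x. pr (f x) (g x))"
  using assms(3,4)
proof (induction k arbitrary: f g)
  case 0
  then show ?case by (simp add: bounded_bilinear.continuous_on[OF assms(1)])
next
  case (Suc k)
  have D: "((\<lambda>x. pr (f x) (g x)) has_derivative
      (\<lambda>v. pr (f x) (frechet_derivative g (at x) v) + pr (frechet_derivative f (at x) v) (g x))) (at x)"
    if "x \<in> S" for x
    using Suc.prems that by (intro bounded_bilinear.FDERIV[OF assms(1)] Ck_on_has_derivative)
  have "Ck_on k S (\<lambda>x. frechet_derivative (\<lambda>x. pr (f x) (g x)) (at x) v)" for v
  proof (subst Ck_on_cong[OF assms(2)])
    show "frechet_derivative (\<lambda>x. pr (f x) (g x)) (at x) v =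
      pr (f x) (frechet_derivative g (at x) v) + pr (frechet_derivative f (at x) v) (g x)"
      if "x \<in> S" for x
      using frechet_derivative_eqI[OF D[OF that]] by simp
    show "Ck_on k S (\<lambda>x. pr (f x) (frechet_derivative g (at x) v) +
        pr (frechet_derivative f (at x) v) (g x))"
      by (rule Ck_on_add[OF assms(2)
            Suc.IH[OF Ck_on_lower[OF Suc.prems(1)] Ck_on_frechet_derivative[OF Suc.prems(2)]]
            Suc.IH[OF Ck_on_frechet_derivative[OF Suc.prems(1)] Ck_on_lower[OF Suc.prems(2)]]])
  qed
  then show ?case
    using D by (auto simp: differentiable_def)
qed

lemma Ck_on_inner_const:
  "open S \<Longrightarrow> Ck_on k S f \<Longrightarrow> Ck_on k S (\<lambda>x. f x \<bullet> c)"
  by (rule Ck_on_bilinear[OF bounded_bilinear_inner _ _ Ck_on_const])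

section \<open>Symmetry of second derivatives\<close>

lemma frechet_derivative_line:
  fixes h :: "'e::real_normed_vector \<Rightarrow> real"
  assumes "h differentiable (at (p + s *\<^sub>R v))"
  shows "((\<lambda>s. h (p + s *\<^sub>R v)) has_real_derivative frechet_derivative h (at (p + s *\<^sub>R v)) v) (at s)"
proof -
  have "((\<lambda>s. p + s *\<^sub>R v) has_derivative (\<lambda>s. s *\<^sub>R v)) (at s)"
    by (auto intro!: derivative_eq_intros)
  from diff_chain_at[OF this assms[unfolded frechet_derivative_works]]
  have "((\<lambda>s. h (p + s *\<^sub>R v)) has_derivative
      (\<lambda>r. frechet_derivative h (at (p + s *\<^sub>R v)) (r *\<^sub>R v))) (at s)"
    unfolding o_def .
  moreover have "(\<lambda>r. frechet_derivative h (at (p + s *\<^sub>R v)) (r *\<^sub>R v)) =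
      (*) (frechet_derivative h (at (p + s *\<^sub>R v)) v)"
    by (rule ext) (simp add: linear_scale[OF linear_frechet_derivative[OF assms]] mult.commute)
  ultimately show ?thesis
    by (simp only: has_field_derivative_def)
qed

text \<open>The second difference of \<open>h\<close> over a parallelogram is an increment in direction \<open>v\<close> of increments
  in direction \<open>w\<close>, and the mean value theorem applies to both. It is symmetric in \<open>v\<close> and \<open>w\<close>, so
  exchanging them writes the same number as a value of the other mixed derivative; on shrinking
  parallelograms continuity then identifies the two derivatives at the corner.\<close>

lemma second_difference_mean_value:
  fixes h :: "'e::euclidean_space \<Rightarrow> real"
  assumes C: "Ck_on 2 S h" and t: "0 < t"
    and S: "\<And>a b. 0 \<le> a \<Longrightarrow> a \<le> t \<Longrightarrow> 0 \<le> b \<Longrightarrow> b \<le> t \<Longrightarrow> u + a *\<^sub>R v + b *\<^sub>R w \<in> S"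
  shows "\<exists>a b. 0 < a \<and> a < t \<and> 0 < b \<and> b < t \<and>
    h (u + t *\<^sub>R v + t *\<^sub>R w) - h (u + t *\<^sub>R w) - h (u + t *\<^sub>R v) + h u =
    t * t * frechet_derivative (\<lambda>z. frechet_derivative h (at z) v) (at (u + a *\<^sub>R v + b *\<^sub>R w)) w"
proof -
  let ?h' = "\<lambda>z. frechet_derivative h (at z) v"
  have C2: "Ck_on (Suc 1) S h" and C1: "Ck_on (Suc 0) S ?h'"
    using C by (simp_all add: numeral_2_eq_2)
  define \<phi> where "\<phi> s = h ((u + t *\<^sub>R w) + s *\<^sub>R v) - h (u + s *\<^sub>R v)" for s
  have "(\<phi> has_real_derivative ?h' ((u + t *\<^sub>R w) + s *\<^sub>R v) - ?h' (u + s *\<^sub>R v)) (at s)"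
    if "0 \<le> s" "s \<le> t" for s
    unfolding \<phi>_def
    using S[of s t] S[of s 0] that t
    by (intro DERIV_diff frechet_derivative_line Ck_on_differentiable[OF C2])
      (simp_all add: ac_simps)
  from MVT2[OF t this] obtain a where a: "0 < a" "a < t"
    "\<phi> t - \<phi> 0 = t * (?h' ((u + t *\<^sub>R w) + a *\<^sub>R v) - ?h' (u + a *\<^sub>R v))"
    by auto
  define \<psi> where "\<psi> s = ?h' ((u + a *\<^sub>R v) + s *\<^sub>R w)" for s
  have "(\<psi> has_real_derivative frechet_derivative ?h' (at ((u + a *\<^sub>R v) + s *\<^sub>R w)) w) (at s)"
    if "0 \<le> s" "s \<le> t" for s
    unfolding \<psi>_def
    using S[of a s] that a by (intro frechet_derivative_line Ck_on_differentiable[OF C1]) simp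
  from MVT2[OF t this] obtain b where b: "0 < b" "b < t"
    "\<psi> t - \<psi> 0 = t * frechet_derivative ?h' (at ((u + a *\<^sub>R v) + b *\<^sub>R w)) w"
    by auto
  have "\<phi> t - \<phi> 0 = t * (\<psi> t - \<psi> 0)"
    unfolding a(3) by (simp add: \<psi>_def add_ac)
  with b(3) have "\<phi> t - \<phi> 0 = t * t * frechet_derivative ?h' (at (u + a *\<^sub>R v + b *\<^sub>R w)) w"
    by simp
  moreover have "\<phi> t - \<phi> 0 =
      h (u + t *\<^sub>R v + t *\<^sub>R w) - h (u + t *\<^sub>R w) - h (u + t *\<^sub>R v) + h u"
    by (simp add: \<phi>_def add_ac)
  ultimately show ?thesis using a b by metis
qed

lemma second_derivative_symmetric_real:
  fixes h :: "'e::euclidean_space \<Rightarrow> real"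
  assumes "open S" "u \<in> S" and C: "Ck_on 2 S h"
  shows "frechet_derivative (\<lambda>z. frechet_derivative h (at z) v) (at u) w =
    frechet_derivative (\<lambda>z. frechet_derivative h (at z) w) (at u) v"
proof -
  define F where "F v w z = frechet_derivative (\<lambda>z. frechet_derivative h (at z) v) (at z) w" for v w z
  have cont: "isCont (F v w) u" for v w
  proof -
    have "continuous_on S (F v w)"
      using C by (simp add: numeral_2_eq_2 F_def[abs_def])
    then show ?thesis using assms(1,2) by (simp add: continuous_on_eq_continuous_at)
  qed
  have "\<bar>F v w u - F w v u\<bar> \<le> e" if "0 < e" for e
  proof -
    from that have "0 < e / 2" by simp
    from cont[of v w, unfolded continuous_at_eps_delta, rule_format, OF this]
    obtain d1 where d1: "d1 > 0" "\<And>z. dist z u < d1 \<Longrightarrow> dist (F v w z) (F v w u) < e / 2" by blast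
    from cont[of w v, unfolded continuous_at_eps_delta, rule_format, OF \<open>0 < e / 2\<close>]
    obtain d2 where d2: "d2 > 0" "\<And>z. dist z u < d2 \<Longrightarrow> dist (F w v z) (F w v u) < e / 2" by blast
    from assms(1,2) obtain d3 where d3: "d3 > 0" "\<And>z. dist z u < d3 \<Longrightarrow> z \<in> S"
      unfolding open_dist by blast
    define d where "d = Min {d1, d2, d3}"
    have d: "d > 0" "d \<le> d1" "d \<le> d2" "d \<le> d3" using d1(1) d2(1) d3(1) by (auto simp: d_def)
    define n where "n = norm v + norm w + 1"
    \<comment> \<open>the parallelogram with sides \<open>t v\<close> and \<open>t w\<close> fits into the ball of radius \<open>d\<close>;
      the summand 1 in \<open>n\<close> keeps the denominator positive if \<open>v = w = 0\<close>\<close>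
    define t where "t = d / (2 * n)"
    have N: "n > 0" unfolding n_def using norm_ge_zero[of v] norm_ge_zero[of w] by linarith
    have t: "t > 0" using d N by (simp add: t_def)
    have near: "dist (u + a *\<^sub>R v' + b *\<^sub>R w') u < d"
      if "0 \<le> a" "a \<le> t" "0 \<le> b" "b \<le> t" "norm v' + norm w' = norm v + norm w" for a b v' w'
    proof -
      have "dist (u + a *\<^sub>R v' + b *\<^sub>R w') u \<le> norm (a *\<^sub>R v') + norm (b *\<^sub>R w')"
        by (simp add: dist_norm norm_triangle_ineq add.assoc del: norm_scaleR)
      also have "\<dots> \<le> t * norm v' + t * norm w'"
        using that by (intro add_mono) (auto intro: mult_right_mono)
      also have "\<dots> = t * (norm v + norm w)" using that(5) by (simp add: distrib_left[symmetric])
      also have "\<dots> \<le> t * n" using t by (simp add: n_def)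
      also have "\<dots> = d / 2" using N by (simp add: t_def)
      also have "\<dots> < d" using d by simp
      finally show ?thesis .
    qed
    have inS: "u + a *\<^sub>R v' + b *\<^sub>R w' \<in> S"
      if "0 \<le> a" "a \<le> t" "0 \<le> b" "b \<le> t" "norm v' + norm w' = norm v + norm w" for a b v' w'
      using near[OF that] d d3(2) by force
    obtain a b where ab: "0 < a" "a < t" "0 < b" "b < t"
      "h (u + t *\<^sub>R v + t *\<^sub>R w) - h (u + t *\<^sub>R w) - h (u + t *\<^sub>R v) + h u =
       t * t * F v w (u + a *\<^sub>R v + b *\<^sub>R w)"
      using second_difference_mean_value[OF C t, of u v w] inS unfolding F_def by blast
    obtain a' b' where ab': "0 < a'" "a' < t" "0 < b'" "b' < t"
      "h (u + t *\<^sub>R w + t *\<^sub>R v) - h (u + t *\<^sub>R v) - h (u + t *\<^sub>R w) + h u =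
       t * t * F w v (u + a' *\<^sub>R w + b' *\<^sub>R v)"
      using second_difference_mean_value[OF C t, of u w v] inS[of _ _ w v] unfolding F_def
      by (metis add.commute)
    have "t * t * F v w (u + a *\<^sub>R v + b *\<^sub>R w) = t * t * F w v (u + a' *\<^sub>R w + b' *\<^sub>R v)"
      unfolding ab(5)[symmetric] ab'(5)[symmetric] by (simp add: add_ac)
    then have "F v w (u + a *\<^sub>R v + b *\<^sub>R w) = F w v (u + a' *\<^sub>R w + b' *\<^sub>R v)"
      using t by simp
    moreover have "dist (F v w (u + a *\<^sub>R v + b *\<^sub>R w)) (F v w u) < e / 2"
      using near[of a b v w] ab d by (intro d1(2)) simp
    moreover have "dist (F w v (u + a' *\<^sub>R w + b' *\<^sub>R v)) (F w v u) < e / 2"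
      using near[of a' b' w v] ab' d by (intro d2(2)) simp
    ultimately show ?thesis unfolding dist_real_def by arith
  qed
  then have "\<bar>F v w u - F w v u\<bar> \<le> 0" by (rule field_le_epsilon[of _ 0, simplified])
  then show ?thesis by (simp add: F_def)
qed

lemma second_derivative_symmetric:
  fixes h :: "'e::euclidean_space \<Rightarrow> 'f::euclidean_space"
  assumes S: "open S" "u \<in> S" and C: "Ck_on 2 S h"
  shows "frechet_derivative (\<lambda>z. frechet_derivative h (at z) v) (at u) w =
    frechet_derivative (\<lambda>z. frechet_derivative h (at z) w) (at u) v"
proof (rule euclidean_eqI)
  fix i :: 'f
  have component: "frechet_derivative (\<lambda>z. k z \<bullet> i) (at z) a = frechet_derivative k (at z) a \<bullet> i"
    if "z \<in> S" "Ck_on (Suc n) S k" for z a n and k :: "'e \<Rightarrow> 'f"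
    by (simp add: frechet_derivative_eqI[OF has_derivative_inner_left[OF Ck_on_has_derivative[OF that(2,1)]]])
  have C2: "Ck_on (Suc 1) S h" and C1: "Ck_on (Suc 0) S (\<lambda>z. frechet_derivative h (at z) a)" for a
    using C by (simp_all add: numeral_2_eq_2)
  have "frechet_derivative (\<lambda>z. frechet_derivative h (at z) a) (at u) b \<bullet> i =
      frechet_derivative (\<lambda>z. frechet_derivative (\<lambda>z. h z \<bullet> i) (at z) a) (at u) b" for a b
    by (subst component[OF S(2) C1, symmetric],
        subst frechet_derivative_cong_open[OF S component[OF _ C2, symmetric]]) simp_all
  then show "frechet_derivative (\<lambda>z. frechet_derivative h (at z) v) (at u) w \<bullet> i =
      frechet_derivative (\<lambda>z. frechet_derivative h (at z) w) (at u) v \<bullet> i"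
    using second_derivative_symmetric_real[OF S Ck_on_inner_const[OF S(1) C]] by simp
qed

section \<open>Directional derivatives along a vector field on an open set\<close>

definition dir_deriv :: "('e \<Rightarrow> 'e) \<Rightarrow> ('e::euclidean_space \<Rightarrow> 'f::real_normed_vector) \<Rightarrow> 'e \<Rightarrow> 'f" where
  "dir_deriv x h u = frechet_derivative h (at u) (x u)"

lemma dir_deriv_cong:
  assumes "open S" "u \<in> S" "\<And>z. z \<in> S \<Longrightarrow> h z = k z"
  shows "dir_deriv x h u = dir_deriv x k u"
  by (simp add: dir_deriv_def frechet_derivative_cong_open[OF assms])

text \<open>Class C^k is defined through derivatives in constant directions; the coordinates of \<open>x\<close> reduce
  derivatives along a variable field to those.\<close>

lemma dir_deriv_coordinates:
  assumes "h differentiable (at u)"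
  shows "dir_deriv x h u = (\<Sum>b\<in>Basis. (x u \<bullet> b) *\<^sub>R frechet_derivative h (at u) b)"
proof -
  interpret linear "frechet_derivative h (at u)"
    by (rule linear_frechet_derivative[OF assms])
  have "frechet_derivative h (at u) (x u) = frechet_derivative h (at u) (\<Sum>b\<in>Basis. (x u \<bullet> b) *\<^sub>R b)"
    by (simp add: euclidean_representation)
  then show ?thesis by (simp add: dir_deriv_def sum scale)
qed

lemma Ck_on_dir_deriv:
  assumes S: "open S" and x: "Ck_on k S x" and h: "Ck_on (Suc k) S h"
  shows "Ck_on k S (dir_deriv x h)"
proof (subst Ck_on_cong[OF S])
  show "dir_deriv x h u = (\<Sum>b\<in>Basis. (x u \<bullet> b) *\<^sub>R frechet_derivative h (at u) b)" if "u \<in> S" for u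
    by (rule dir_deriv_coordinates[OF Ck_on_differentiable[OF h that]])
  show "Ck_on k S (\<lambda>u. \<Sum>b\<in>Basis. (x u \<bullet> b) *\<^sub>R frechet_derivative h (at u) b)"
    by (rule Ck_on_sum[OF S finite_Basis],
        rule Ck_on_bilinear[OF bounded_bilinear_scaleR S Ck_on_inner_const[OF S x]
          Ck_on_frechet_derivative[OF h]])
qed

text \<open>Differentiating \<open>y(h)\<close> along \<open>x\<close> gives the Hessian of \<open>h\<close>, which is symmetric in \<open>x\<close> and \<open>y\<close>
  and hence disappears from the commutator, and a first-order term.\<close>

lemma dir_deriv_dir_deriv:
  fixes h :: "'e::euclidean_space \<Rightarrow> 'f::euclidean_space"
  assumes S: "open S" "u \<in> S" and y: "Ck_on 1 S y" and h: "Ck_on 2 S h"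
  shows "dir_deriv x (dir_deriv y h) u =
    frechet_derivative (\<lambda>z. frechet_derivative h (at z) (y u)) (at u) (x u) +
    dir_deriv (dir_deriv x y) h u"
proof -
  let ?d = "\<lambda>b z. frechet_derivative h (at z) b"
  have h2: "Ck_on (Suc 1) S h" and h1: "Ck_on (Suc 0) S (?d b)" and y1: "Ck_on (Suc 0) S y" for b
    using h y by (simp_all add: numeral_2_eq_2)
  have d: "(?d b has_derivative frechet_derivative (?d b) (at u)) (at u)" for b
    by (rule Ck_on_has_derivative[OF h1 S(2)])
  have dy: "(y has_derivative frechet_derivative y (at u)) (at u)"
    by (rule Ck_on_has_derivative[OF y1 S(2)])
  have coords: "?d a z = (\<Sum>b\<in>Basis. (a \<bullet> b) *\<^sub>R ?d b z)" if "z \<in> S" for a z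
    using dir_deriv_coordinates[OF Ck_on_differentiable[OF h2 that], of "\<lambda>_. a"]
    by (simp add: dir_deriv_def)
  have 1: "((\<lambda>z. \<Sum>b\<in>Basis. (y z \<bullet> b) *\<^sub>R ?d b z) has_derivative
      (\<lambda>v. \<Sum>b\<in>Basis. (y u \<bullet> b) *\<^sub>R frechet_derivative (?d b) (at u) v +
        (frechet_derivative y (at u) v \<bullet> b) *\<^sub>R ?d b u)) (at u)"
    by (intro has_derivative_sum has_derivative_scaleR has_derivative_inner_left d dy)
  have 2: "((\<lambda>z. \<Sum>b\<in>Basis. (y u \<bullet> b) *\<^sub>R ?d b z) has_derivative
      (\<lambda>v. \<Sum>b\<in>Basis. (y u \<bullet> b) *\<^sub>R frechet_derivative (?d b) (at u) v)) (at u)"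
    by (intro has_derivative_sum has_derivative_scaleR_right d)
  have "frechet_derivative (dir_deriv y h) (at u) (x u) =
     (\<Sum>b\<in>Basis. (y u \<bullet> b) *\<^sub>R frechet_derivative (?d b) (at u) (x u) +
        (frechet_derivative y (at u) (x u) \<bullet> b) *\<^sub>R ?d b u)"
    by (subst frechet_derivative_cong_open[OF S, of _ "\<lambda>z. \<Sum>b\<in>Basis. (y z \<bullet> b) *\<^sub>R ?d b z"])
      (simp_all add: dir_deriv_def coords[of _ "y _"] frechet_derivative_eqI[OF 1])
  moreover have "frechet_derivative (?d (y u)) (at u) (x u) =
     (\<Sum>b\<in>Basis. (y u \<bullet> b) *\<^sub>R frechet_derivative (?d b) (at u) (x u))"
    by (subst frechet_derivative_cong_open[OF S, of _ "\<lambda>z. \<Sum>b\<in>Basis. (y u \<bullet> b) *\<^sub>R ?d b z"])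
      (simp_all add: coords[of _ "y u"] frechet_derivative_eqI[OF 2])
  ultimately show ?thesis
    using coords[OF S(2), of "frechet_derivative y (at u) (x u)"]
    by (simp add: dir_deriv_def sum.distrib)
qed

lemma dir_deriv_diff_field:
  assumes "h differentiable (at u)"
  shows "dir_deriv (\<lambda>z. x z - y z) h u = dir_deriv x h u - dir_deriv y h u"
  by (simp add: dir_deriv_def linear_diff[OF linear_frechet_derivative[OF assms]])

lemma dir_deriv_diff:
  assumes "h differentiable (at u)" "k differentiable (at u)"
  shows "dir_deriv x (\<lambda>z. h z - k z) u = dir_deriv x h u - dir_deriv x k u"
  unfolding dir_deriv_def
  using frechet_derivative_eqI[OF has_derivative_diff[OF assms[unfolded frechet_derivative_works]]]
  by simp

lemma dir_deriv_commutator: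
  fixes h :: "'e::euclidean_space \<Rightarrow> 'f::euclidean_space"
  assumes S: "open S" "u \<in> S" and x: "Ck_on 1 S x" and y: "Ck_on 1 S y" and h: "Ck_on 2 S h"
  shows "dir_deriv x (dir_deriv y h) u - dir_deriv y (dir_deriv x h) u =
    dir_deriv (\<lambda>z. dir_deriv x y z - dir_deriv y x z) h u"
proof -
  have "h differentiable (at u)"
    using h S(2) by (auto simp: numeral_2_eq_2)
  then show ?thesis
    unfolding dir_deriv_dir_deriv[OF S x h] dir_deriv_dir_deriv[OF S y h]
    using second_derivative_symmetric[OF S h, of "x u" "y u"]
    by (simp add: dir_deriv_diff_field)
qed

text \<open>Since \<open>[y, z]\<close> is itself the difference of the derivatives of \<open>z\<close> along \<open>y\<close> and of \<open>y\<close> along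
  \<open>z\<close>, the commutator formula turns every double bracket into four twofold derivatives, and these
  cancel in the cyclic sum.\<close>

lemma dir_deriv_Jacobi:
  fixes x y z :: "'e::euclidean_space \<Rightarrow> 'e"
  assumes S: "open S" "u \<in> S" and C: "Ck_on 2 S x" "Ck_on 2 S y" "Ck_on 2 S z"
  defines "br \<equiv> (\<lambda>x y u. dir_deriv x y u - dir_deriv y x u :: 'e)"
  shows "br x (br y z) u + br y (br z x) u + br z (br x y) u = 0"
proof -
  have C1: "Ck_on 1 S x" "Ck_on 1 S y" "Ck_on 1 S z"
    using C by (auto simp: numeral_2_eq_2 simp del: Ck_on.simps intro: Ck_on_lower)
  have diff: "dir_deriv a b differentiable (at u)" if "Ck_on 1 S a" "Ck_on 2 S b" for a b :: "'e \<Rightarrow> 'e"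
    using Ck_on_dir_deriv[OF S(1), of 1 a b] that S(2) by (auto simp: numeral_2_eq_2)
  have expand: "br a (br b c) u = dir_deriv a (dir_deriv b c) u - dir_deriv a (dir_deriv c b) u
      - (dir_deriv b (dir_deriv c a) u - dir_deriv c (dir_deriv b a) u)"
    if "Ck_on 2 S a" "Ck_on 1 S b" "Ck_on 2 S b" "Ck_on 1 S c" "Ck_on 2 S c" for a b c
    using that dir_deriv_commutator[OF S, of b c a] dir_deriv_diff[OF diff diff, of b c c b a]
    by (simp add: br_def)
  show ?thesis
    using C C1 by (simp add: expand)
qed

section \<open>Calculus in the charts of a manifold\<close>

definition fun_in_chart :: "('a, 'e) chart \<Rightarrow> ('a \<Rightarrow> real) \<Rightarrow> 'e \<Rightarrow> real" where
  "fun_in_chart c f x = f (chart_inv c x)"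

definition vf_in_chart :: "('a, 'e) chart \<Rightarrow> ('a, 'e) vfield \<Rightarrow> 'e \<Rightarrow> 'e" where
  "vf_in_chart c X x = X (chart_inv c x) c"

lemma Ck_function_in_chart:
  "Ck_function A k f \<longleftrightarrow> (\<forall>c\<in>A. Ck_on k (snd c ` fst c) (fun_in_chart c f))"
  by (simp add: Ck_function_def fun_in_chart_def[abs_def])

lemma Ck_vfield_in_chart:
  "Ck_vfield A k X \<longleftrightarrow> (\<forall>p. X p \<in> tangent_space A p) \<and>
     (\<forall>c\<in>A. Ck_on k (snd c ` fst c) (vf_in_chart c X))"
  by (simp add: Ck_vfield_def vf_in_chart_def[abs_def])

lemma Ck_function_mono: "Ck_function A k f \<Longrightarrow> j \<le> k \<Longrightarrow> Ck_function A j f"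
  unfolding Ck_function_def by (blast intro: Ck_on_mono)

lemma Ck_vfield_mono: "Ck_vfield A k X \<Longrightarrow> j \<le> k \<Longrightarrow> Ck_vfield A j X"
  unfolding Ck_vfield_def by (blast intro: Ck_on_mono)

lemma Ck_function_const: "Ck_function A k (\<lambda>_. a)"
  by (simp add: Ck_function_def Ck_on_const)

lemma Ck_vfield_tangent: "Ck_vfield A k X \<Longrightarrow> X p \<in> tangent_space A p"
  by (simp add: Ck_vfield_def)

lemma tangent_space_outside: "v \<in> tangent_space A p \<Longrightarrow> c \<notin> A \<or> p \<notin> fst c \<Longrightarrow> v c = 0"
  unfolding tangent_space_def by blast

lemma fscale_apply [simp]: "(f \<odot> X) p c = f p *\<^sub>R X p c"
  by (simp add: fscale_def)

lemma fscale_assoc: "f \<odot> (h \<odot> X) = (\<lambda>p. f p * h p) \<odot> X"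
  by (simp add: fun_eq_iff)

lemma fscale_minus_one: "(\<lambda>_. - 1) \<odot> X = - X"
  by (simp add: fun_eq_iff)

lemma fscale_add_right: "f \<odot> (X + Y) = f \<odot> X + f \<odot> Y"
  by (simp add: fun_eq_iff algebra_simps)

lemma lie_bracket_in_chart:
  assumes "c \<in> A" "p \<in> fst c" "chart_inv c (snd c p) = p"
  shows "lie_bracket A X Y p c = dir_deriv (vf_in_chart c X) (vf_in_chart c Y) (snd c p) -
    dir_deriv (vf_in_chart c Y) (vf_in_chart c X) (snd c p)"
  using assms by (simp add: lie_bracket_def dir_deriv_def vf_in_chart_def[abs_def])

context smooth_manifold
begin

lemma chart_domain_subset: "c \<in> A \<Longrightarrow> fst c \<subseteq> topspace T"
  using charts_cover by blast

lemma chart_inv_left: "c \<in> A \<Longrightarrow> p \<in> fst c \<Longrightarrow> chart_inv c (snd c p) = p"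
  using homeomorphic_imp_injective_map[OF chart_homeomorphic, of c] chart_domain_subset[of c]
  unfolding chart_inv_def by (intro inv_into_f_f) (simp_all add: Int_absorb1)

lemma chart_inv_in_domain: "c \<in> A \<Longrightarrow> x \<in> snd c ` fst c \<Longrightarrow> chart_inv c x \<in> fst c"
  using chart_inv_left[of c] by auto

lemma chart_inv_right: "c \<in> A \<Longrightarrow> x \<in> snd c ` fst c \<Longrightarrow> snd c (chart_inv c x) = x"
  using chart_inv_left[of c] by auto

lemma chart_overlap_open:
  assumes "c \<in> A" "d \<in> A"
  shows "open (snd c ` (fst c \<inter> fst d))"
proof -
  have "openin (subtopology T (fst c)) (fst c \<inter> fst d)"
    using chart_domain_open[OF assms(2)] by (auto simp: openin_subtopology)
  then have "openin (top_of_set (snd c ` fst c)) (snd c ` (fst c \<inter> fst d))"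
    using homeomorphic_imp_open_map[OF chart_homeomorphic[OF assms(1)]] by (simp add: open_map_def)
  then show ?thesis
    using chart_image_open[OF assms(1)] by (simp add: openin_open_eq)
qed

lemma transition_has_derivative:
  assumes "c \<in> A" "d \<in> A" "p \<in> fst c" "p \<in> fst d"
  shows "(transition c d has_derivative frechet_derivative (transition c d) (at (snd c p))) (at (snd c p))"
  using assms(3,4) by (intro Ck_on_has_derivative[OF charts_compatible[OF assms(1,2), of "Suc 0"]]) auto

lemma tangent_space_change_chart:
  "v \<in> tangent_space A p \<Longrightarrow> c \<in> A \<Longrightarrow> d \<in> A \<Longrightarrow> p \<in> fst c \<Longrightarrow> p \<in> fst d \<Longrightarrow>
    v d = frechet_derivative (transition c d) (at (snd c p)) (v c)"
  unfolding tangent_space_def by blast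

text \<open>Derivatives of transition maps are linear.\<close>

lemma tangent_space_linear_combination:
  assumes "v \<in> tangent_space A p" "w \<in> tangent_space A p"
  shows "(\<lambda>c. a *\<^sub>R v c + b *\<^sub>R w c) \<in> tangent_space A p"
proof -
  have "a *\<^sub>R v d + b *\<^sub>R w d =
      frechet_derivative (transition c d) (at (snd c p)) (a *\<^sub>R v c + b *\<^sub>R w c)"
    if "c \<in> A" "d \<in> A" "p \<in> fst c" "p \<in> fst d" for c d
  proof -
    interpret linear "frechet_derivative (transition c d) (at (snd c p))"
      using transition_has_derivative[OF that] by (rule has_derivative_linear)
    show ?thesis
      using assms that by (simp add: add scale tangent_space_change_chart[of _ p c d])
  qed
  moreover have "a *\<^sub>R v c + b *\<^sub>R w c = 0" if "c \<notin> A \<or> p \<notin> fst c" for c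
    using assms[THEN tangent_space_outside, OF that] by simp
  ultimately show ?thesis
    unfolding tangent_space_def by blast
qed

lemma tangent_space_add:
  "v \<in> tangent_space A p \<Longrightarrow> w \<in> tangent_space A p \<Longrightarrow> v + w \<in> tangent_space A p"
  using tangent_space_linear_combination[of v p w 1 1] by (simp add: plus_fun_def)

lemma tangent_space_scale:
  "v \<in> tangent_space A p \<Longrightarrow> (\<lambda>c. a *\<^sub>R v c) \<in> tangent_space A p"
  using tangent_space_linear_combination[of v p v a 0] by simp

lemma Ck_vfield_fscale:
  assumes "Ck_function A k f" "Ck_vfield A k X"
  shows "Ck_vfield A k (f \<odot> X)"
proof -
  have "(f \<odot> X) p \<in> tangent_space A p" for p
    using tangent_space_scale[OF Ck_vfield_tangent[OF assms(2)]] by (simp add: fscale_def)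
  moreover have "Ck_on k (snd c ` fst c) (\<lambda>x. (f \<odot> X) (chart_inv c x) c)" if "c \<in> A" for c
    using assms that unfolding Ck_function_def Ck_vfield_def fscale_apply
    by (intro Ck_on_bilinear[OF bounded_bilinear_scaleR chart_image_open[OF that]]) auto
  ultimately show ?thesis
    by (simp add: Ck_vfield_def)
qed

lemma Ck_vfield_add:
  assumes "Ck_vfield A k X" "Ck_vfield A k Y"
  shows "Ck_vfield A k (X + Y)"
  using assms unfolding Ck_vfield_def
  by (auto intro: tangent_space_add Ck_on_add[OF chart_image_open])

lemma Ck_vfield_minus: "Ck_vfield A k X \<Longrightarrow> Ck_vfield A k (- X)"
  using Ck_vfield_fscale[OF Ck_function_const[of A k "- 1"], of X] by (simp add: fscale_minus_one)

lemma Ck_vfield_diff: "Ck_vfield A k X \<Longrightarrow> Ck_vfield A k Y \<Longrightarrow> Ck_vfield A k (X - Y)"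
  using Ck_vfield_add[OF _ Ck_vfield_minus, of k X Y] by simp

lemma Ck_function_mult:
  assumes "Ck_function A k f" "Ck_function A k h"
  shows "Ck_function A k (\<lambda>p. f p * h p)"
  using assms unfolding Ck_function_def
  by (auto intro: Ck_on_bilinear[OF bounded_bilinear_mult chart_image_open])

lemma vfield_outside:
  assumes "Ck_vfield A k X" "p \<notin> topspace T"
  shows "X p c = 0"
  using tangent_space_outside[OF Ck_vfield_tangent[OF assms(1)], of c p] chart_domain_subset[of c] assms(2)
  by blast

text \<open>Vector fields vanish off the manifold, so identities between functions that hold on the manifold
  become identities between fields.\<close>

lemma fscale_cong:
  assumes "Ck_vfield A k X" "\<And>p. p \<in> topspace T \<Longrightarrow> f p = h p"
  shows "f \<odot> X = h \<odot> X"
proof (intro ext)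
  show "(f \<odot> X) p c = (h \<odot> X) p c" for p c
    by (cases "p \<in> topspace T") (simp_all add: assms(2) vfield_outside[OF assms(1)])
qed

text \<open>The two coordinate expressions of \<open>V(f)\<close> agree by the chain rule for the transition map, so
  the arbitrary chart in the definition of \<open>V(f)\<close> may be replaced by any other.\<close>

lemma vderiv_in_chart:
  assumes c: "c \<in> A" "p \<in> fst c" and X: "Ck_vfield A k X" and f: "Ck_function A 1 f"
  shows "vderiv A X f p = dir_deriv (vf_in_chart c X) (fun_in_chart c f) (snd c p)"
proof -
  define d where "d = (SOME c. c \<in> A \<and> p \<in> fst c)"
  have d: "d \<in> A" "p \<in> fst d"
    using someI[of "\<lambda>c. c \<in> A \<and> p \<in> fst c" c] c by (auto simp: d_def)
  have f1: "Ck_on (Suc 0) (snd d ` fst d) (fun_in_chart d f)"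
    using f d(1) by (simp add: Ck_function_in_chart)
  have "transition c d (snd c p) = snd d p"
    using chart_inv_left[OF c] by (simp add: transition_def)
  then have "(fun_in_chart d f has_derivative frechet_derivative (fun_in_chart d f) (at (snd d p)))
      (at (transition c d (snd c p)))"
    using Ck_on_has_derivative[OF f1, of "snd d p"] d(2) by simp
  from diff_chain_at[OF transition_has_derivative[OF c(1) d(1) c(2) d(2)] this]
  have "(fun_in_chart c f has_derivative
      frechet_derivative (fun_in_chart d f) (at (snd d p)) \<circ>
      frechet_derivative (transition c d) (at (snd c p))) (at (snd c p))"
  proof (rule has_derivative_transform_within_open[OF _ chart_overlap_open[OF c(1) d(1)]])
    show "snd c p \<in> snd c ` (fst c \<inter> fst d)"
      using c d by blast
    show "(fun_in_chart d f \<circ> transition c d) x = fun_in_chart c f x"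
      if "x \<in> snd c ` (fst c \<inter> fst d)" for x
      using that chart_inv_left[OF c(1)] chart_inv_left[OF d(1)]
      by (auto simp: fun_in_chart_def transition_def)
  qed
  then have "frechet_derivative (fun_in_chart c f) (at (snd c p)) (X p c) =
      frechet_derivative (fun_in_chart d f) (at (snd d p)) (X p d)"
    using tangent_space_change_chart[OF Ck_vfield_tangent[OF X] c(1) d(1) c(2) d(2)]
    by (simp add: frechet_derivative_eqI)
  then show ?thesis
    using chart_inv_left[OF c]
    by (simp add: vderiv_def Let_def dir_deriv_def vf_in_chart_def fun_in_chart_def[abs_def]
        d_def[symmetric])
qed

lemma vderiv_at_chart_inv:
  assumes "c \<in> A" "x \<in> snd c ` fst c" "Ck_vfield A k X" "Ck_function A 1 f"
  shows "fun_in_chart c (vderiv A X f) x = dir_deriv (vf_in_chart c X) (fun_in_chart c f) x"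
  using vderiv_in_chart[OF assms(1) chart_inv_in_domain[OF assms(1,2)] assms(3,4)] chart_inv_right[OF assms(1,2)]
  by (simp add: fun_in_chart_def[abs_def])

lemma Ck_function_vderiv:
  assumes X: "Ck_vfield A k X" and f: "Ck_function A (Suc k) f"
  shows "Ck_function A k (vderiv A X f)"
  unfolding Ck_function_in_chart
proof
  fix c assume c: "c \<in> A"
  have f1: "Ck_function A 1 f"
    using f by (rule Ck_function_mono) simp
  have "Ck_on k (snd c ` fst c) (dir_deriv (vf_in_chart c X) (fun_in_chart c f))"
    using X f c by (intro Ck_on_dir_deriv[OF chart_image_open[OF c]])
      (simp_all only: Ck_function_in_chart Ck_vfield_in_chart)
  then show "Ck_on k (snd c ` fst c) (fun_in_chart c (vderiv A X f))"
    by (subst Ck_on_cong[OF chart_image_open[OF c] vderiv_at_chart_inv[OF c _ X f1]]) auto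
qed

lemma vderiv_cong:
  assumes p: "p \<in> topspace T" and eq: "\<And>q. q \<in> topspace T \<Longrightarrow> f q = h q"
  shows "vderiv A X f p = vderiv A X h p"
proof -
  define c where "c = (SOME c. c \<in> A \<and> p \<in> fst c)"
  have c: "c \<in> A" "p \<in> fst c"
    using someI_ex[of "\<lambda>c. c \<in> A \<and> p \<in> fst c"] p charts_cover unfolding c_def by blast+
  have "frechet_derivative (\<lambda>x. f (chart_inv c x)) (at (snd c p)) =
      frechet_derivative (\<lambda>x. h (chart_inv c x)) (at (snd c p))"
    using c chart_inv_in_domain[OF c(1)] chart_domain_subset[OF c(1)] eq
    by (intro frechet_derivative_cong_open[OF chart_image_open[OF c(1)]]) blast+
  then show ?thesis
    by (simp add: vderiv_def Let_def c_def)
qed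

lemma vderiv_add:
  assumes p: "p \<in> topspace T" and X: "Ck_vfield A k X"
    and f: "Ck_function A 1 f" and h: "Ck_function A 1 h"
  shows "vderiv A X (\<lambda>q. f q + h q) p = vderiv A X f p + vderiv A X h p"
proof -
  obtain c where c: "c \<in> A" "p \<in> fst c"
    using p charts_cover by blast
  have S: "snd c p \<in> snd c ` fst c"
    using c by blast
  have f1: "Ck_on (Suc 0) (snd c ` fst c) (fun_in_chart c f)"
    and h1: "Ck_on (Suc 0) (snd c ` fst c) (fun_in_chart c h)"
    using f h c by (simp_all only: Ck_function_in_chart One_nat_def)
  have sum: "Ck_function A 1 (\<lambda>q. f q + h q)"
    using f h Ck_on_add[OF chart_image_open] unfolding Ck_function_def by blast
  show ?thesis
    using has_derivative_add[OF Ck_on_has_derivative[OF f1 S] Ck_on_has_derivative[OF h1 S]]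
    by (simp add: vderiv_in_chart[OF c X f] vderiv_in_chart[OF c X h] vderiv_in_chart[OF c X sum]
        dir_deriv_def fun_in_chart_def[abs_def] frechet_derivative_eqI)
qed

lemma vderiv_const: "vderiv A X (\<lambda>_. a) p = 0"
  by (simp add: vderiv_def Let_def)

lemma vderiv_mult:
  assumes p: "p \<in> topspace T" and X: "Ck_vfield A k X"
    and f: "Ck_function A 1 f" and h: "Ck_function A 1 h"
  shows "vderiv A X (\<lambda>q. f q * h q) p = f p * vderiv A X h p + vderiv A X f p * h p"
proof -
  obtain c where c: "c \<in> A" "p \<in> fst c"
    using p charts_cover by blast
  have S: "snd c p \<in> snd c ` fst c"
    using c by blast
  have f1: "Ck_on (Suc 0) (snd c ` fst c) (fun_in_chart c f)"
    and h1: "Ck_on (Suc 0) (snd c ` fst c) (fun_in_chart c h)"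
    using f h c by (simp_all only: Ck_function_in_chart One_nat_def)
  have "((\<lambda>x. fun_in_chart c f x * fun_in_chart c h x) has_derivative
      (\<lambda>v. fun_in_chart c f (snd c p) * frechet_derivative (fun_in_chart c h) (at (snd c p)) v +
        frechet_derivative (fun_in_chart c f) (at (snd c p)) v * fun_in_chart c h (snd c p))) (at (snd c p))"
    by (rule has_derivative_mult[OF Ck_on_has_derivative[OF f1 S] Ck_on_has_derivative[OF h1 S]])
  then show ?thesis
    using chart_inv_left[OF c]
    by (simp add: vderiv_in_chart[OF c X f] vderiv_in_chart[OF c X h]
        vderiv_in_chart[OF c X Ck_function_mult[OF f h]] dir_deriv_def
        fun_in_chart_def[abs_def] frechet_derivative_eqI)
qed

lemma vderiv_cube:
  assumes p: "p \<in> topspace T" and X: "Ck_vfield A k X" and f: "Ck_function A 1 f"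
  shows "vderiv A X (\<lambda>q. f q * (f q * f q)) p = 3 * f p * f p * vderiv A X f p"
  by (simp add: vderiv_mult[OF p X f Ck_function_mult[OF f f]] vderiv_mult[OF p X f f] algebra_simps)

lemma vderiv_commutator:
  assumes p: "p \<in> topspace T" and X: "Ck_vfield A 1 X" and Y: "Ck_vfield A 1 Y"
    and f: "Ck_function A 2 f" and XY: "Ck_vfield A k (lie_bracket A X Y)"
  shows "vderiv A X (vderiv A Y f) p - vderiv A Y (vderiv A X f) p = vderiv A (lie_bracket A X Y) f p"
proof -
  obtain c where c: "c \<in> A" "p \<in> fst c"
    using p charts_cover by blast
  let ?S = "snd c ` fst c"
  have S: "open ?S" "snd c p \<in> ?S"
    using chart_image_open c by auto
  have f1: "Ck_function A 1 f"
    using f by (rule Ck_function_mono) simp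
  have second: "vderiv A V (vderiv A W f) p =
      dir_deriv (vf_in_chart c V) (dir_deriv (vf_in_chart c W) (fun_in_chart c f)) (snd c p)"
    if "Ck_vfield A 1 V" "Ck_vfield A 1 W" for V W
    using f vderiv_in_chart[OF c that(1) Ck_function_vderiv[OF that(2)], of f]
      dir_deriv_cong[OF S vderiv_at_chart_inv[OF c(1) _ that(2) f1]]
    by (simp add: numeral_2_eq_2)
  have br: "vf_in_chart c (lie_bracket A X Y) (snd c p) =
      dir_deriv (vf_in_chart c X) (vf_in_chart c Y) (snd c p) -
      dir_deriv (vf_in_chart c Y) (vf_in_chart c X) (snd c p)"
    using lie_bracket_in_chart[OF c chart_inv_left[OF c]] chart_inv_left[OF c]
    by (simp add: vf_in_chart_def)
  have "vderiv A (lie_bracket A X Y) f p =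
      dir_deriv (\<lambda>z. dir_deriv (vf_in_chart c X) (vf_in_chart c Y) z -
        dir_deriv (vf_in_chart c Y) (vf_in_chart c X) z) (fun_in_chart c f) (snd c p)"
    unfolding vderiv_in_chart[OF c XY f1] by (simp add: dir_deriv_def br)
  then show ?thesis
    using dir_deriv_commutator[OF S, of "vf_in_chart c X" "vf_in_chart c Y" "fun_in_chart c f"]
      X Y f c(1)
    by (simp add: second Ck_vfield_in_chart Ck_function_in_chart)
qed

lemma vf_in_chart_lie_bracket:
  assumes "c \<in> A" "x \<in> snd c ` fst c"
  shows "vf_in_chart c (lie_bracket A X Y) x =
    dir_deriv (vf_in_chart c X) (vf_in_chart c Y) x - dir_deriv (vf_in_chart c Y) (vf_in_chart c X) x"
  using lie_bracket_in_chart[OF assms(1) chart_inv_in_domain[OF assms], of X Y]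
    chart_inv_right[OF assms] by (simp add: vf_in_chart_def)

lemma lie_bracket_Jacobi:
  assumes C: "Ck_vfield A 2 X" "Ck_vfield A 2 Y" "Ck_vfield A 2 Z"
  shows "lie_bracket A X (lie_bracket A Y Z) + lie_bracket A Y (lie_bracket A Z X) +
    lie_bracket A Z (lie_bracket A X Y) = 0"
proof (intro ext)
  fix p c
  show "(lie_bracket A X (lie_bracket A Y Z) + lie_bracket A Y (lie_bracket A Z X) +
    lie_bracket A Z (lie_bracket A X Y)) p c = 0 p c"
  proof (cases "c \<in> A \<and> p \<in> fst c")
    case True
    then have c: "c \<in> A" "p \<in> fst c" by auto
    have S: "open (snd c ` fst c)" "snd c p \<in> snd c ` fst c"
      using chart_image_open c by auto
    define br where "br x y = (\<lambda>u. dir_deriv x y u - dir_deriv y x u :: 'e)" for x y :: "'e \<Rightarrow> 'e"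
    have "lie_bracket A U (lie_bracket A V W) p c =
        br (vf_in_chart c U) (br (vf_in_chart c V) (vf_in_chart c W)) (snd c p)" for U V W
    proof -
      have "br (vf_in_chart c U) (vf_in_chart c (lie_bracket A V W)) (snd c p) =
          br (vf_in_chart c U) (br (vf_in_chart c V) (vf_in_chart c W)) (snd c p)"
        using dir_deriv_cong[OF S vf_in_chart_lie_bracket[OF c(1)]] vf_in_chart_lie_bracket[OF c(1) S(2)]
        by (simp add: br_def dir_deriv_def)
      then show ?thesis
        by (simp add: br_def lie_bracket_in_chart[OF c chart_inv_left[OF c]])
    qed
    then show ?thesis
      using dir_deriv_Jacobi[OF S, of "vf_in_chart c X" "vf_in_chart c Y" "vf_in_chart c Z"]
        C c(1)
      by (simp add: br_def Ck_vfield_in_chart)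
  qed (auto simp: lie_bracket_def)
qed

text \<open>The product rule in a chart, in both arguments.\<close>

lemma lie_bracket_fscale:
  assumes X: "Ck_vfield A 1 X" and Y: "Ck_vfield A 1 Y"
    and f: "Ck_function A 1 f" and h: "Ck_function A 1 h"
  shows "lie_bracket A (f \<odot> X) (h \<odot> Y) =
    (\<lambda>p. f p * h p) \<odot> lie_bracket A X Y + (\<lambda>p. f p * vderiv A X h p) \<odot> Y
    - (\<lambda>p. h p * vderiv A Y f p) \<odot> X"
proof (intro ext)
  fix p c
  show "lie_bracket A (f \<odot> X) (h \<odot> Y) p c =
    ((\<lambda>p. f p * h p) \<odot> lie_bracket A X Y + (\<lambda>p. f p * vderiv A X h p) \<odot> Y
    - (\<lambda>p. h p * vderiv A Y f p) \<odot> X) p c"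
  proof (cases "c \<in> A \<and> p \<in> fst c")
    case True
    then have c: "c \<in> A" "p \<in> fst c" by auto
    let ?S = "snd c ` fst c"
    have product: "dir_deriv (vf_in_chart c (k \<odot> V)) (vf_in_chart c (l \<odot> W)) (snd c p) =
        (k p * l p) *\<^sub>R dir_deriv (vf_in_chart c V) (vf_in_chart c W) (snd c p) +
        (k p * vderiv A V l p) *\<^sub>R W p c"
      if V: "Ck_vfield A 1 V" and W: "Ck_vfield A 1 W" and l: "Ck_function A 1 l" for k l V W
    proof -
      have l1: "Ck_on (Suc 0) ?S (fun_in_chart c l)" and W1: "Ck_on (Suc 0) ?S (vf_in_chart c W)"
        using l W c by (simp_all only: Ck_function_in_chart Ck_vfield_in_chart One_nat_def)
      interpret l: linear "frechet_derivative (fun_in_chart c l) (at (snd c p))"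
        using has_derivative_linear[OF Ck_on_has_derivative[OF l1]] c by blast
      interpret W: linear "frechet_derivative (vf_in_chart c W) (at (snd c p))"
        using has_derivative_linear[OF Ck_on_has_derivative[OF W1]] c by blast
      have "((\<lambda>x. fun_in_chart c l x *\<^sub>R vf_in_chart c W x) has_derivative
        (\<lambda>v. fun_in_chart c l (snd c p) *\<^sub>R frechet_derivative (vf_in_chart c W) (at (snd c p)) v +
          frechet_derivative (fun_in_chart c l) (at (snd c p)) v *\<^sub>R vf_in_chart c W (snd c p)))
        (at (snd c p))"
        using c by (intro has_derivative_scaleR Ck_on_has_derivative[OF l1] Ck_on_has_derivative[OF W1]) auto
      moreover have "vf_in_chart c (l \<odot> W) = (\<lambda>x. fun_in_chart c l x *\<^sub>R vf_in_chart c W x)"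
        by (simp add: fun_eq_iff vf_in_chart_def fun_in_chart_def)
      ultimately have "frechet_derivative (vf_in_chart c (l \<odot> W)) (at (snd c p)) =
        (\<lambda>v. fun_in_chart c l (snd c p) *\<^sub>R frechet_derivative (vf_in_chart c W) (at (snd c p)) v +
          frechet_derivative (fun_in_chart c l) (at (snd c p)) v *\<^sub>R vf_in_chart c W (snd c p))"
        by (simp add: frechet_derivative_eqI)
      moreover have "vf_in_chart c (k \<odot> V) (snd c p) = k p *\<^sub>R vf_in_chart c V (snd c p)"
        "fun_in_chart c l (snd c p) = l p" "vf_in_chart c W (snd c p) = W p c"
        using chart_inv_left[OF c] by (simp_all add: vf_in_chart_def fun_in_chart_def)
      ultimately show ?thesis
        by (simp add: vderiv_in_chart[OF c V l] dir_deriv_def l.scale W.scale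
            mult.commute)
    qed
    show ?thesis
      by (simp add: lie_bracket_in_chart[OF c chart_inv_left[OF c]] product[OF X Y h]
          product[OF Y X f] algebra_simps)
  next
    case False
    then show ?thesis
      using tangent_space_outside[OF Ck_vfield_tangent[OF X], of c p]
        tangent_space_outside[OF Ck_vfield_tangent[OF Y], of c p]
      by (auto simp: lie_bracket_def)
  qed
qed

end

section \<open>Tensoriality of the curvature of a connection\<close>

lemma lie_bracket_skew: "lie_bracket A Y X = - lie_bracket A X Y"
  by (simp add: lie_bracket_def fun_eq_iff)

lemma smooth_vfield_Ck: "smooth_vfield A X \<Longrightarrow> Ck_vfield A k X"
  by (simp add: smooth_vfield_def)

context linear_connection
begin

lemma smooth_connection: "smooth_vfield A X \<Longrightarrow> smooth_vfield A Y \<Longrightarrow> smooth_vfield A (D X Y)"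
  unfolding smooth_vfield_def using connection_Ck by blast

lemma smooth_vfield_diff: "smooth_vfield A X \<Longrightarrow> smooth_vfield A Y \<Longrightarrow> smooth_vfield A (X - Y)"
  unfolding smooth_vfield_def using Ck_vfield_diff by blast

lemma connection_minus_left:
  assumes "Ck_vfield A 0 X" "Ck_vfield A 1 Y"
  shows "D (- X) Y = - D X Y"
  using connection_scale_left[OF Ck_function_const assms, of "- 1"] by (simp add: fscale_minus_one)

lemma connection_diff_left:
  assumes "Ck_vfield A 0 X" "Ck_vfield A 0 X'" "Ck_vfield A 1 Y"
  shows "D (X - X') Y = D X Y - D X' Y"
  using connection_add_left[OF assms(1) Ck_vfield_minus[OF assms(2)] assms(3)]
    connection_minus_left[OF assms(2,3)] by simp

lemma connection_minus_right:
  assumes "Ck_vfield A 0 X" "Ck_vfield A 1 Y"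
  shows "D X (- Y) = - D X Y"
proof -
  have "vderiv A X (\<lambda>_. - 1) \<odot> Y = 0"
    by (simp add: fun_eq_iff vderiv_const)
  then show ?thesis
    using connection_Leibniz[OF Ck_function_const assms, of "- 1"] by (simp add: fscale_minus_one)
qed

lemma connection_diff_right:
  assumes "Ck_vfield A 0 X" "Ck_vfield A 1 Y" "Ck_vfield A 1 Y'"
  shows "D X (Y - Y') = D X Y - D X Y'"
  using connection_add_right[OF assms(1,2) Ck_vfield_minus[OF assms(3)]]
    connection_minus_right[OF assms(1,3)] by simp

lemma curvature_skew:
  assumes "Ck_vfield A 0 (lie_bracket A X Y)" "Ck_vfield A 1 Z"
  shows "curvature A D Y X Z = - curvature A D X Y Z"
  by (simp add: curvature_def lie_bracket_skew[of A Y X] connection_minus_left[OF assms])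

text \<open>The derivative \<open>X(h)\<close> enters once through the Leibniz rule for \<open>D\<^bsub>X\<^esub> (h D\<^bsub>Y\<^esub> Z)\<close> and once through
  the bracket, with opposite signs; the same holds for \<open>Y(f)\<close>. The hypothesis on \<open>[X, Y]\<close> says that the
  bracket is a continuous vector field, without which \<open>D [X, Y] Z\<close> is arbitrary.\<close>

lemma curvature_fscale_fields:
  assumes X: "Ck_vfield A 1 X" and Y: "Ck_vfield A 1 Y" and XY: "Ck_vfield A 0 (lie_bracket A X Y)"
    and f: "Ck_function A 1 f" and h: "Ck_function A 1 h" and Z: "Ck_vfield A 2 Z"
  shows "curvature A D (f \<odot> X) (h \<odot> Y) Z = (\<lambda>p. f p * h p) \<odot> curvature A D X Y Z"
proof -
  have X0: "Ck_vfield A 0 X" and Y0: "Ck_vfield A 0 Y" and Z1: "Ck_vfield A 1 Z"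
    using X Y Z by (auto intro: Ck_vfield_mono)
  have f0: "Ck_function A 0 f" and h0: "Ck_function A 0 h"
    using f h by (auto intro: Ck_function_mono)
  have Xh: "Ck_function A 0 (vderiv A X h)" and Yf: "Ck_function A 0 (vderiv A Y f)"
    using X0 Y0 f h by (auto intro!: Ck_function_vderiv)
  have DZ: "Ck_vfield A 1 (D V Z)" if "Ck_vfield A 1 V" for V
    using connection_Ck[OF that, of Z] Z by (simp add: numeral_2_eq_2)
  have iterated: "D (k \<odot> V) (D (l \<odot> W) Z) =
      (\<lambda>p. k p * vderiv A V l p) \<odot> D W Z + (\<lambda>p. k p * l p) \<odot> D V (D W Z)"
    if "Ck_function A 0 k" "Ck_vfield A 0 V" "Ck_function A 1 l" "Ck_function A 0 l"
      "Ck_vfield A 1 W" "Ck_vfield A 0 W" for k l V W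
    using that DZ[OF that(5)]
    by (simp only: connection_scale_left[OF that(4,6) Z1] connection_Leibniz[OF that(3,2)]
        connection_scale_left[OF that(1,2) Ck_vfield_fscale[OF that(3)]] fscale_add_right fscale_assoc)
  have "D (lie_bracket A (f \<odot> X) (h \<odot> Y)) Z =
      (\<lambda>p. f p * h p) \<odot> D (lie_bracket A X Y) Z + (\<lambda>p. f p * vderiv A X h p) \<odot> D Y Z
      - (\<lambda>p. h p * vderiv A Y f p) \<odot> D X Z"
  proof -
    note C = Ck_function_mult[OF f0 h0] Ck_function_mult[OF f0 Xh] Ck_function_mult[OF h0 Yf]
    note V = Ck_vfield_fscale[OF C(1) XY] Ck_vfield_fscale[OF C(2) Y0] Ck_vfield_fscale[OF C(3) X0]
    show ?thesis
      unfolding lie_bracket_fscale[OF X Y f h] connection_diff_left[OF Ck_vfield_add[OF V(1,2)] V(3) Z1]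
        connection_add_left[OF V(1,2) Z1] connection_scale_left[OF C(1) XY Z1]
        connection_scale_left[OF C(2) Y0 Z1] connection_scale_left[OF C(3) X0 Z1] ..
  qed
  then show ?thesis
    unfolding curvature_def
    by (simp add: iterated[OF f0 X0 h h0 Y Y0] iterated[OF h0 Y0 f f0 X X0] fun_eq_iff algebra_simps)
qed

text \<open>The mixed first-order terms are symmetric in \<open>X\<close> and \<open>Y\<close>, and the second derivatives of \<open>f\<close>
  leave \<open>X(Y(f)) - Y(X(f)) - [X, Y](f) = 0\<close>.\<close>

lemma curvature_fscale_argument:
  assumes X: "Ck_vfield A 1 X" and Y: "Ck_vfield A 1 Y" and XY: "Ck_vfield A 0 (lie_bracket A X Y)"
    and f: "Ck_function A 2 f" and Z: "Ck_vfield A 2 Z"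
  shows "curvature A D X Y (f \<odot> Z) = f \<odot> curvature A D X Y Z"
proof -
  have X0: "Ck_vfield A 0 X" and Y0: "Ck_vfield A 0 Y" and Z1: "Ck_vfield A 1 Z"
    using X Y Z by (auto intro: Ck_vfield_mono)
  have f1: "Ck_function A 1 f"
    using f by (auto intro: Ck_function_mono)
  have DZ: "Ck_vfield A 1 (D V Z)" if "Ck_vfield A 1 V" for V
    using connection_Ck[OF that, of Z] Z by (simp add: numeral_2_eq_2)
  have Df: "Ck_function A 1 (vderiv A V f)" if "Ck_vfield A 1 V" for V
    using Ck_function_vderiv[OF that, of f] f by (simp add: numeral_2_eq_2)
  have iterated: "D V (D W (f \<odot> Z)) = vderiv A V (vderiv A W f) \<odot> Z + vderiv A W f \<odot> D V Z
      + (vderiv A V f \<odot> D W Z + f \<odot> D V (D W Z))"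
    if "Ck_vfield A 0 V" "Ck_vfield A 1 W" "Ck_vfield A 0 W" for V W
    unfolding connection_Leibniz[OF f1 that(3) Z1]
      connection_add_right[OF that(1) Ck_vfield_fscale[OF Df[OF that(2)] Z1]
        Ck_vfield_fscale[OF f1 DZ[OF that(2)]]]
      connection_Leibniz[OF Df[OF that(2)] that(1) Z1]
      connection_Leibniz[OF f1 that(1) DZ[OF that(2)]] ..
  have commutator: "(\<lambda>p. vderiv A X (vderiv A Y f) p - vderiv A Y (vderiv A X f) p) \<odot> Z =
      vderiv A (lie_bracket A X Y) f \<odot> Z"
    by (rule fscale_cong[OF Z vderiv_commutator[OF _ X Y f XY]])
  have "curvature A D X Y (f \<odot> Z) = f \<odot> curvature A D X Y Z
      + ((\<lambda>p. vderiv A X (vderiv A Y f) p - vderiv A Y (vderiv A X f) p) \<odot> Z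
      - vderiv A (lie_bracket A X Y) f \<odot> Z)"
    unfolding curvature_def iterated[OF X0 Y Y0] iterated[OF Y0 X X0]
      connection_Leibniz[OF f1 XY Z1]
    by (simp add: fun_eq_iff algebra_simps)
  then show ?thesis
    by (simp add: commutator)
qed

lemma curvature_fscale:
  assumes X: "Ck_vfield A 1 X" and Y: "Ck_vfield A 1 Y" and XY: "Ck_vfield A 0 (lie_bracket A X Y)"
    and f: "Ck_function A 1 f" and h: "Ck_function A 1 h" and k: "Ck_function A 2 k"
    and Z: "Ck_vfield A 2 Z"
  shows "curvature A D (f \<odot> X) (h \<odot> Y) (k \<odot> Z) = (\<lambda>p. f p * (h p * k p)) \<odot> curvature A D X Y Z"
  unfolding curvature_fscale_fields[OF X Y XY f h Ck_vfield_fscale[OF k Z]]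
    curvature_fscale_argument[OF X Y XY k Z] by (simp add: fscale_assoc mult.assoc)

end

section \<open>Curvature of the Levi-Civita connection on smooth vector fields\<close>

text \<open>Twice the difference of the two sides is a signed sum of four instances of the cyclic identity,
  one for each choice of the argument that stays in the last place.\<close>

lemma pair_symmetry:
  fixes K :: "'v \<Rightarrow> 'v \<Rightarrow> 'v \<Rightarrow> 'v \<Rightarrow> real"
  assumes V: "x \<in> V" "y \<in> V" "z \<in> V" "w \<in> V"
    and skew12: "\<And>a b c d. a \<in> V \<Longrightarrow> b \<in> V \<Longrightarrow> c \<in> V \<Longrightarrow> d \<in> V \<Longrightarrow> K b a c d = - K a b c d"
    and skew34: "\<And>a b c d. a \<in> V \<Longrightarrow> b \<in> V \<Longrightarrow> c \<in> V \<Longrightarrow> d \<in> V \<Longrightarrow> K a b d c = - K a b c d"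
    and cyclic: "\<And>a b c d. a \<in> V \<Longrightarrow> b \<in> V \<Longrightarrow> c \<in> V \<Longrightarrow> d \<in> V \<Longrightarrow>
      K a b c d + K b c a d + K c a b d = 0"
  shows "K x y z w = K z w x y"
  using cyclic[of x y z w] cyclic[of y z w x] cyclic[of z w x y] cyclic[of w x y z]
    skew34[of x y z w] skew34[of y z x w] skew34[of z w x y] skew34[of w y x z] skew12[of y w x z]
    skew34[of w x y z] skew34[of x z y w] skew12[of z x y w] V
  by simp

context levi_civita_connection
begin

lemma smooth_tangent: "smooth_vfield A X \<Longrightarrow> X p \<in> tangent_space A p"
  using smooth_vfield_Ck by (rule Ck_vfield_tangent)

text \<open>By torsion-freeness the coordinate formula for the bracket inherits its smoothness and its
  transformation behaviour from the connection.\<close>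

lemma smooth_lie_bracket: "smooth_vfield A X \<Longrightarrow> smooth_vfield A Y \<Longrightarrow> smooth_vfield A (lie_bracket A X Y)"
  using smooth_vfield_diff[OF smooth_connection smooth_connection, of X Y Y X] torsion_free[of X Y] by simp

lemma smooth_curvature:
  "smooth_vfield A X \<Longrightarrow> smooth_vfield A Y \<Longrightarrow> smooth_vfield A Z \<Longrightarrow>
    smooth_vfield A (curvature A D X Y Z)"
  unfolding curvature_def by (intro smooth_vfield_diff smooth_connection smooth_lie_bracket)

lemma curvature_skew_smooth:
  "smooth_vfield A X \<Longrightarrow> smooth_vfield A Y \<Longrightarrow> smooth_vfield A Z \<Longrightarrow>
    curvature A D Y X Z = - curvature A D X Y Z"
  by (intro curvature_skew smooth_vfield_Ck smooth_lie_bracket)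

text \<open>Only the bracket needs an argument: it is additive because it is a difference of covariant
  derivatives.\<close>

lemma curvature_diff_left:
  assumes X: "smooth_vfield A X" and X': "smooth_vfield A X'" and Y: "smooth_vfield A Y"
    and Z: "smooth_vfield A Z"
  shows "curvature A D (X - X') Y Z = curvature A D X Y Z - curvature A D X' Y Z"
proof -
  note [simp] = assms smooth_connection smooth_lie_bracket smooth_vfield_diff smooth_vfield_Ck
    connection_diff_left connection_diff_right
  have "lie_bracket A (X - X') Y = lie_bracket A X Y - lie_bracket A X' Y"
    by (simp add: torsion_free[symmetric])
  then show ?thesis
    by (simp add: curvature_def)
qed

text \<open>By vanishing torsion the second covariant derivatives combine to \<open>D\<^bsub>X\<^esub> [Y, Z]\<close> and its cyclic
  images, and \<open>D\<^bsub>X\<^esub> [Y, Z] - D\<^bsub>[Y, Z]\<^esub> X\<close> is \<open>[X, [Y, Z]]\<close>, so that the Jacobi identity remains.\<close>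

lemma first_Bianchi:
  assumes X: "smooth_vfield A X" and Y: "smooth_vfield A Y" and Z: "smooth_vfield A Z"
  shows "curvature A D X Y Z + curvature A D Y Z X + curvature A D Z X Y = 0"
proof -
  note smooth = assms smooth_connection smooth_lie_bracket smooth_vfield_diff
  have "lie_bracket A U (lie_bracket A V W) = D U (D V W) - D U (D W V) - D (lie_bracket A V W) U"
    if "smooth_vfield A U" "smooth_vfield A V" "smooth_vfield A W" for U V W
    unfolding torsion_free[OF that(1) smooth_lie_bracket[OF that(2,3)], symmetric]
    by (simp add: torsion_free[OF that(2,3), symmetric] connection_diff_right smooth_vfield_Ck smooth that)
  then have "curvature A D X Y Z + curvature A D Y Z X + curvature A D Z X Y =
      lie_bracket A X (lie_bracket A Y Z) + lie_bracket A Y (lie_bracket A Z X) +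
      lie_bracket A Z (lie_bracket A X Y)"
    by (simp add: assms curvature_def)
  then show ?thesis
    using lie_bracket_Jacobi[of X Y Z] assms by (simp add: smooth_vfield_Ck)
qed

lemma metric_minus:
  "\<lbrakk>p \<in> topspace T; u \<in> tangent_space A p; v \<in> tangent_space A p\<rbrakk> \<Longrightarrow> g p (- u) v = - g p u v"
  using metric_scale[of p u v "- 1"] by (simp add: fun_Compl_def)

text \<open>Differentiate \<open>\<langle>Z, W\<rangle>\<close> along \<open>X\<close> and \<open>Y\<close> in both orders. The mixed terms cancel in the
  commutator, which equals the derivative along \<open>[X, Y]\<close>; what is left is
  \<open>\<langle>R(X, Y) Z, W\<rangle> + \<langle>Z, R(X, Y) W\<rangle> = 0\<close>.\<close>

lemma metric_curvature_skew:
  assumes X: "smooth_vfield A X" and Y: "smooth_vfield A Y" and Z: "smooth_vfield A Z"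
    and W: "smooth_vfield A W" and p: "p \<in> topspace T"
  shows "g p (curvature A D X Y Z p) (W p) = - g p (curvature A D X Y W p) (Z p)"
proof -
  let ?G = "\<lambda>U V q. g q (U q) (V q)"
  note smooth = assms smooth_connection smooth_lie_bracket
  have G: "Ck_function A k (?G U V)" if "smooth_vfield A U" "smooth_vfield A V" for U V k
    using metric_smooth[OF that] by (simp add: smooth_function_def)
  have second: "vderiv A U (vderiv A V (?G Z W)) p =
      ?G (D U (D V Z)) W p + ?G (D V Z) (D U W) p + (?G (D U Z) (D V W) p + ?G Z (D U (D V W)) p)"
    if U: "smooth_vfield A U" and V: "smooth_vfield A V" for U V
  proof -
    have "vderiv A U (vderiv A V (?G Z W)) p = vderiv A U (\<lambda>q. ?G (D V Z) W q + ?G Z (D V W) q) p"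
      using metric_compatible[OF V Z W] by (intro vderiv_cong[OF p]) simp
    also have "\<dots> = vderiv A U (?G (D V Z) W) p + vderiv A U (?G Z (D V W)) p"
      by (rule vderiv_add[OF p smooth_vfield_Ck[OF U]]; intro G smooth that)
    finally show ?thesis
      by (simp add: metric_compatible smooth that)
  qed
  have commutator: "vderiv A X (vderiv A Y (?G Z W)) p - vderiv A Y (vderiv A X (?G Z W)) p =
      ?G (D (lie_bracket A X Y) Z) W p + ?G Z (D (lie_bracket A X Y) W) p"
    using vderiv_commutator[OF p smooth_vfield_Ck[OF X] smooth_vfield_Ck[OF Y] G[OF Z W]
        smooth_vfield_Ck[OF smooth_lie_bracket[OF X Y]]]
      metric_compatible[OF smooth_lie_bracket[OF X Y] Z W p] by simp
  have expand: "?G (curvature A D X Y V) U p =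
      ?G (D X (D Y V)) U p - ?G (D Y (D X V)) U p - ?G (D (lie_bracket A X Y) V) U p"
    if V: "smooth_vfield A V" and U: "smooth_vfield A U" for U V
  proof -
    have diff: "g p (u - v) (U p) = g p u (U p) - g p v (U p)"
      if "u \<in> tangent_space A p" "v \<in> tangent_space A p" for u v
    proof -
      have "u - v \<in> tangent_space A p"
        using tangent_space_linear_combination[OF that, of 1 "- 1"] by (simp add: fun_diff_def)
      from metric_add[OF p this that(2) smooth_tangent[OF U]] show ?thesis by simp
    qed
    have "D X (D Y V) p - D Y (D X V) p \<in> tangent_space A p"
      using smooth_tangent[OF smooth_vfield_diff[of "D X (D Y V)" "D Y (D X V)"]] by (simp add: smooth that)
    then show ?thesis
      unfolding curvature_def by (simp add: diff smooth_tangent smooth that)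
  qed
  show ?thesis
    using second[OF X Y] second[OF Y X] commutator
    by (simp add: expand Z W metric_sym[OF p smooth_tangent smooth_tangent, of Z]
        metric_sym[OF p smooth_tangent smooth_tangent, of "D X Z"]
        metric_sym[OF p smooth_tangent smooth_tangent, of "D Y Z"] smooth)
qed

lemma metric_curvature_skew_fields:
  assumes "smooth_vfield A X" "smooth_vfield A Y" "smooth_vfield A Z" "smooth_vfield A W"
    and p: "p \<in> topspace T"
  shows "g p (curvature A D X Y Z p) (W p) = - g p (curvature A D Y X Z p) (W p)"
  using metric_minus[OF p smooth_tangent smooth_tangent, of "curvature A D Y X Z" W] assms
  by (simp add: curvature_skew_smooth[of Y X Z] smooth_curvature)

lemma metric_first_Bianchi:
  assumes "smooth_vfield A X" "smooth_vfield A Y" "smooth_vfield A Z" "smooth_vfield A W"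
    and p: "p \<in> topspace T"
  shows "g p (curvature A D X Y Z p) (W p) + g p (curvature A D Y Z X p) (W p) +
    g p (curvature A D Z X Y p) (W p) = 0"
proof -
  have "curvature A D X Y Z p + curvature A D Y Z X p + curvature A D Z X Y p = 0"
    using first_Bianchi[of X Y Z] assms by (simp add: fun_eq_iff)
  then have "g p (curvature A D X Y Z p + curvature A D Y Z X p + curvature A D Z X Y p) (W p) = 0"
    using metric_scale[OF p smooth_tangent smooth_tangent, of W W 0] assms by (simp add: zero_fun_def)
  then show ?thesis
    using assms by (simp add: metric_add smooth_tangent tangent_space_add smooth_curvature)
qed

lemma metric_curvature_exchange:
  assumes "smooth_vfield A X" "smooth_vfield A Y" "smooth_vfield A Z" "smooth_vfield A W"
    and p: "p \<in> topspace T"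
  shows "g p (curvature A D X Y Z p) (W p) = g p (curvature A D Z W X p) (Y p)"
proof (rule pair_symmetry[where V = "Collect (smooth_vfield A)" and
      K = "\<lambda>X Y Z W. g p (curvature A D X Y Z p) (W p)"])
  fix a b c d
  assume "a \<in> Collect (smooth_vfield A)" "b \<in> Collect (smooth_vfield A)"
    "c \<in> Collect (smooth_vfield A)" "d \<in> Collect (smooth_vfield A)"
  then have V: "smooth_vfield A a" "smooth_vfield A b" "smooth_vfield A c" "smooth_vfield A d"
    by simp_all
  show "g p (curvature A D b a c p) (d p) = - g p (curvature A D a b c p) (d p)"
    by (rule metric_curvature_skew_fields[OF V(2,1,3,4) p])
  show "g p (curvature A D a b d p) (c p) = - g p (curvature A D a b c p) (d p)"
    by (rule metric_curvature_skew[OF V(1,2,4,3) p])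
  show "g p (curvature A D a b c p) (d p) + g p (curvature A D b c a p) (d p) +
      g p (curvature A D c a b p) (d p) = 0"
    by (rule metric_first_Bianchi[OF V p])
qed (simp_all add: assms)

text \<open>Write \<open>R(Y, Z)\<close> as \<open>[D\<^bsub>Y\<^esub>, D\<^bsub>Z\<^esub>] - D\<^bsub>[Y, Z]\<^esub>\<close>. The double commutators \<open>[D\<^bsub>X\<^esub>, [D\<^bsub>Y\<^esub>, D\<^bsub>Z\<^esub>]]\<close> cancel
  cyclically. The commutator \<open>[D\<^bsub>X\<^esub>, D\<^bsub>[Y, Z]\<^esub>]\<close> is \<open>R(X, [Y, Z]) + D\<^bsub>[X, [Y, Z]]\<^esub>\<close>: its second part
  vanishes cyclically by the Jacobi identity, and its first part cancels against the terms
  \<open>R(D\<^bsub>X\<^esub> Y, Z) + R(Y, D\<^bsub>X\<^esub> Z)\<close>, which vanishing torsion collects to \<open>R([X, Y], Z)\<close> and its cyclic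
  images.\<close>

lemma second_Bianchi:
  assumes X: "smooth_vfield A X" and Y: "smooth_vfield A Y" and Z: "smooth_vfield A Z"
    and W: "smooth_vfield A W"
  defines "R \<equiv> curvature A D"
  shows "tensor_cov_deriv D R X Y Z W + tensor_cov_deriv D R Y Z X W + tensor_cov_deriv D R Z X Y W = 0"
proof -
  note smooth = X Y Z W smooth_connection smooth_lie_bracket smooth_vfield_diff smooth_curvature
  have derivative: "tensor_cov_deriv D R U V S W =
      D U (D V (D S W)) - D U (D S (D V W)) - (D V (D S (D U W)) - D S (D V (D U W)))
      - R U (lie_bracket A V S) W - D (lie_bracket A U (lie_bracket A V S)) W
      - R (D U V) S W + R (D U S) V W"
    if "smooth_vfield A U" "smooth_vfield A V" "smooth_vfield A S" for U V S
  proof -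
    have "R V (D U S) W = - R (D U S) V W"
      unfolding R_def using that by (intro curvature_skew_smooth smooth)
    moreover have "D U (R V S W) = D U (D V (D S W)) - D U (D S (D V W)) - D U (D (lie_bracket A V S) W)"
      by (simp add: R_def curvature_def connection_diff_right smooth that smooth_vfield_Ck)
    ultimately show ?thesis
      by (simp add: tensor_cov_deriv_def R_def curvature_def)
  qed
  have torsion: "R (lie_bracket A U V) S W = R (D U V) S W - R (D V U) S W"
    if "smooth_vfield A U" "smooth_vfield A V" "smooth_vfield A S" for U V S
    unfolding R_def
    by (simp add: torsion_free[OF that(1,2), symmetric] curvature_diff_left smooth that)
  have skew: "R U (lie_bracket A V S) W = - R (lie_bracket A V S) U W"
    if "smooth_vfield A U" "smooth_vfield A V" "smooth_vfield A S" for U V S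
    unfolding R_def using that by (intro curvature_skew_smooth smooth)
  have "D (lie_bracket A X (lie_bracket A Y Z)) W + D (lie_bracket A Y (lie_bracket A Z X)) W +
      D (lie_bracket A Z (lie_bracket A X Y)) W = D (lie_bracket A X (lie_bracket A Y Z) +
        lie_bracket A Y (lie_bracket A Z X) + lie_bracket A Z (lie_bracket A X Y)) W"
    by (simp add: connection_add_left Ck_vfield_add smooth smooth_vfield_Ck)
  also have "\<dots> = D 0 W"
    by (simp only: lie_bracket_Jacobi[OF smooth_vfield_Ck[OF X] smooth_vfield_Ck[OF Y] smooth_vfield_Ck[OF Z]])
  also have "\<dots> = 0"
    using connection_diff_left[of X X W] by (simp add: X W smooth_vfield_Ck)
  finally show ?thesis
    by (simp add: derivative X Y Z skew torsion algebra_simps)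
qed

end

section \<open>The stochastic curvature tensor\<close>

context levi_civita_connection
begin

lemma curvature_fscale_smooth:
  assumes "smooth_vfield A X" "smooth_vfield A Y" "smooth_vfield A Z"
    and "Ck_function A 2 f" "Ck_function A 2 h" "Ck_function A 2 k"
  shows "curvature A D (f \<odot> X) (h \<odot> Y) (k \<odot> Z) = (\<lambda>p. f p * (h p * k p)) \<odot> curvature A D X Y Z"
  using assms by (intro curvature_fscale smooth_vfield_Ck smooth_lie_bracket)
    (auto intro: Ck_function_mono)

lemma stochastic_curvature_eq:
  assumes "smooth_vfield A X" "smooth_vfield A Y" "smooth_vfield A Z" "Ck_function A 2 e"
  shows "stochastic_curvature A D e X Y Z = (\<lambda>p. e p * (e p * e p)) \<odot> curvature A D X Y Z"
  unfolding stochastic_curvature_def by (intro curvature_fscale_smooth assms)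

lemma stochastic_riemann_eq:
  assumes X: "smooth_vfield A X" and Y: "smooth_vfield A Y" and Z: "smooth_vfield A Z"
    and W: "smooth_vfield A W" and e: "Ck_function A 2 e" and p: "p \<in> topspace T"
  shows "stochastic_riemann A g D e X Y Z W p = e p ^ 4 * g p (curvature A D Z W X p) (Y p)"
proof -
  have scale: "g p ((a \<odot> U) p) ((b \<odot> V) p) = a p * b p * g p (U p) (V p)"
    if U: "smooth_vfield A U" and V: "smooth_vfield A V" for a b U V
    using metric_scale[OF p smooth_tangent[OF U] tangent_space_scale[OF smooth_tangent[OF V]]]
      metric_sym[OF p smooth_tangent[OF U] tangent_space_scale[OF smooth_tangent[OF V]]]
      metric_scale[OF p smooth_tangent[OF V] smooth_tangent[OF U]] metric_sym[OF p smooth_tangent[OF U] smooth_tangent[OF V]]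
    by (simp add: fscale_def)
  show ?thesis
    unfolding stochastic_riemann_def curvature_fscale_smooth[OF Z W X e e e]
      scale[OF smooth_curvature[OF Z W X] Y]
    by (simp add: power4_eq_xxxx mult_ac)
qed

text \<open>The stochastic tensor has to be evaluated at \<open>D\<^bsub>\<epsilon>X\<^esub> Y = \<epsilon> D\<^bsub>X\<^esub> Y\<close>, where tensoriality is used with
  the factor \<open>\<epsilon>\<^sup>2\<close> in that argument. This makes \<open>\<epsilon>\<^sup>4\<close> the common factor of all terms except the one
  in which \<open>\<epsilon>\<^sup>3\<close> is differentiated.\<close>

lemma tensor_cov_deriv_stochastic:
  assumes X: "smooth_vfield A X" and Y: "smooth_vfield A Y" and Z: "smooth_vfield A Z"
    and W: "smooth_vfield A W" and e: "Ck_function A 2 e"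
  shows "tensor_cov_deriv D (stochastic_curvature A D e) (e \<odot> X) Y Z W =
    (\<lambda>p. e p ^ 4) \<odot> tensor_cov_deriv D (curvature A D) X Y Z W +
    (\<lambda>p. 3 * e p ^ 3) \<odot> (vderiv A X e \<odot> curvature A D Y Z W)"
proof -
  let ?R = "curvature A D" and ?Rt = "stochastic_curvature A D e"
  let ?e3 = "\<lambda>p. e p * (e p * e p)"
  note smooth = X Y Z W smooth_connection smooth_curvature
  have e1: "Ck_function A 1 e" and e0: "Ck_function A 0 e"
    using e by (auto intro: Ck_function_mono)
  have e31: "Ck_function A 1 ?e3"
    by (intro Ck_function_mult e1)
  have X0: "Ck_vfield A 0 X"
    by (rule smooth_vfield_Ck[OF X])
  have DX: "D (e \<odot> X) V = e \<odot> D X V" if "smooth_vfield A V" for V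
    by (rule connection_scale_left[OF e0 X0 smooth_vfield_Ck[OF that]])
  have R1: "Ck_vfield A 1 (?R Y Z W)"
    by (intro smooth_vfield_Ck smooth)
  have cube: "vderiv A X ?e3 \<odot> ?R Y Z W = (\<lambda>p. 3 * e p * e p * vderiv A X e p) \<odot> ?R Y Z W"
    by (rule fscale_cong[OF R1 vderiv_cube[OF _ X0 e1]])
  have "D (e \<odot> X) (?Rt Y Z W) = e \<odot> (vderiv A X ?e3 \<odot> ?R Y Z W + ?e3 \<odot> D X (?R Y Z W))"
    unfolding stochastic_curvature_eq[OF Y Z W e]
      connection_scale_left[OF e0 X0 Ck_vfield_fscale[OF e31 R1]] connection_Leibniz[OF e31 X0 R1] ..
  moreover have "?Rt (e \<odot> D X Y) Z W = (\<lambda>p. e p ^ 4) \<odot> ?R (D X Y) Z W"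
    "?Rt Y (e \<odot> D X Z) W = (\<lambda>p. e p ^ 4) \<odot> ?R Y (D X Z) W"
    "?Rt Y Z (e \<odot> D X W) = (\<lambda>p. e p ^ 4) \<odot> ?R Y Z (D X W)"
    unfolding stochastic_curvature_def fscale_assoc
    by (simp_all add: curvature_fscale_smooth smooth e Ck_function_mult power4_eq_xxxx mult.assoc)
  ultimately show ?thesis
    unfolding tensor_cov_deriv_def cube
    by (simp add: DX smooth fun_eq_iff algebra_simps power3_eq_cube power4_eq_xxxx)
qed

end

theorem theorem2:
  fixes T :: "'a topology" and A :: "('a, 'e::euclidean_space) chart set"
    and g :: "'a \<Rightarrow> ('a, 'e) tangent \<Rightarrow> ('a, 'e) tangent \<Rightarrow> real"
    and D :: "('a, 'e) vfield \<Rightarrow> ('a, 'e) vfield \<Rightarrow> ('a, 'e) vfield"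
    and P :: "'w measure" and \<epsilon> :: "'w \<Rightarrow> 'a \<Rightarrow> real"
  assumes "riemannian_manifold T A g"
    and "levi_civita_connection T A g D"
    and "prob_space P"
    and "\<And>p. p \<in> topspace T \<Longrightarrow> (\<lambda>\<omega>. \<epsilon> \<omega> p) \<in> borel_measurable P"
    and "AE \<omega> in P. Ck_function A 2 (\<epsilon> \<omega>)"
  shows "AE \<omega> in P. \<forall>X Y Z W.
    smooth_vfield A X \<and> smooth_vfield A Y \<and> smooth_vfield A Z \<and> smooth_vfield A W \<longrightarrow>
    (\<forall>p\<in>topspace T.
      (let e = \<epsilon> \<omega>; R = curvature A D; Rt = stochastic_curvature A D e;
           Rm = stochastic_riemann A g D e
       in
        (Rm X Y Z W p = - Rm Y X Z W p \<and> Rm X Y Z W p = - Rm X Y W Z p) \<and>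
        Rm X Y Z W p = Rm Z W X Y p \<and>
        Rm X Y Z W p + Rm Z Y W X p + Rm W Y X Z p = 0 \<and>
        (tensor_cov_deriv D Rt (e \<odot> X) Y Z W + tensor_cov_deriv D Rt (e \<odot> Y) Z X W
           + tensor_cov_deriv D Rt (e \<odot> Z) X Y W) p
        = ((\<lambda>q. 3 * e q ^ 3) \<odot>
             (vderiv A X e \<odot> R Y Z W + vderiv A Y e \<odot> R Z X W + vderiv A Z e \<odot> R X Y W)) p))"
  using assms(5)
proof (rule eventually_mono)
  interpret levi_civita_connection T A g D
    by (rule assms(2))
  fix \<omega> assume e: "Ck_function A 2 (\<epsilon> \<omega>)"
  show "\<forall>X Y Z W.
    smooth_vfield A X \<and> smooth_vfield A Y \<and> smooth_vfield A Z \<and> smooth_vfield A W \<longrightarrow>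
    (\<forall>p\<in>topspace T.
      (let e = \<epsilon> \<omega>; R = curvature A D; Rt = stochastic_curvature A D e;
           Rm = stochastic_riemann A g D e
       in
        (Rm X Y Z W p = - Rm Y X Z W p \<and> Rm X Y Z W p = - Rm X Y W Z p) \<and>
        Rm X Y Z W p = Rm Z W X Y p \<and>
        Rm X Y Z W p + Rm Z Y W X p + Rm W Y X Z p = 0 \<and>
        (tensor_cov_deriv D Rt (e \<odot> X) Y Z W + tensor_cov_deriv D Rt (e \<odot> Y) Z X W
           + tensor_cov_deriv D Rt (e \<odot> Z) X Y W) p
        = ((\<lambda>q. 3 * e q ^ 3) \<odot>
             (vderiv A X e \<odot> R Y Z W + vderiv A Y e \<odot> R Z X W + vderiv A Z e \<odot> R X Y W)) p))"
    unfolding Let_def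
  proof (intro allI impI ballI conjI; elim conjE)
    fix X Y Z W p
    assume X: "smooth_vfield A X" and Y: "smooth_vfield A Y" and Z: "smooth_vfield A Z"
      and W: "smooth_vfield A W" and p: "p \<in> topspace T"
    let ?e = "\<epsilon> \<omega>"
    note Rm = stochastic_riemann_eq[OF _ _ _ _ e p]
    show "stochastic_riemann A g D ?e X Y Z W p = - stochastic_riemann A g D ?e Y X Z W p"
      using metric_curvature_skew[OF Z W X Y p] by (simp add: Rm X Y Z W)
    show "stochastic_riemann A g D ?e X Y Z W p = - stochastic_riemann A g D ?e X Y W Z p"
      using metric_curvature_skew_fields[OF Z W X Y p] by (simp add: Rm X Y Z W)
    show "stochastic_riemann A g D ?e X Y Z W p = stochastic_riemann A g D ?e Z W X Y p"
      using metric_curvature_exchange[OF Z W X Y p] by (simp add: Rm X Y Z W)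
    show "stochastic_riemann A g D ?e X Y Z W p + stochastic_riemann A g D ?e Z Y W X p +
        stochastic_riemann A g D ?e W Y X Z p = 0"
      using metric_first_Bianchi[OF Z W X Y p]
      by (simp add: Rm X Y Z W distrib_left[symmetric])
    have Bianchi: "tensor_cov_deriv D (curvature A D) X Y Z W + tensor_cov_deriv D (curvature A D) Y Z X W +
        tensor_cov_deriv D (curvature A D) Z X Y W = 0"
      by (rule second_Bianchi[OF X Y Z W])
    have "tensor_cov_deriv D (stochastic_curvature A D ?e) (?e \<odot> X) Y Z W +
        tensor_cov_deriv D (stochastic_curvature A D ?e) (?e \<odot> Y) Z X W +
        tensor_cov_deriv D (stochastic_curvature A D ?e) (?e \<odot> Z) X Y W =
        (\<lambda>q. ?e q ^ 4) \<odot> (tensor_cov_deriv D (curvature A D) X Y Z W +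
          tensor_cov_deriv D (curvature A D) Y Z X W + tensor_cov_deriv D (curvature A D) Z X Y W) +
        (\<lambda>q. 3 * ?e q ^ 3) \<odot> (vderiv A X ?e \<odot> curvature A D Y Z W +
          vderiv A Y ?e \<odot> curvature A D Z X W + vderiv A Z ?e \<odot> curvature A D X Y W)"
      by (simp add: tensor_cov_deriv_stochastic X Y Z W e fscale_add_right add_ac)
    also have "\<dots> = (\<lambda>q. 3 * ?e q ^ 3) \<odot> (vderiv A X ?e \<odot> curvature A D Y Z W +
          vderiv A Y ?e \<odot> curvature A D Z X W + vderiv A Z ?e \<odot> curvature A D X Y W)"
      unfolding Bianchi by (simp add: fun_eq_iff)
    finally show "(tensor_cov_deriv D (stochastic_curvature A D ?e) (?e \<odot> X) Y Z W +
        tensor_cov_deriv D (stochastic_curvature A D ?e) (?e \<odot> Y) Z X W +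
        tensor_cov_deriv D (stochastic_curvature A D ?e) (?e \<odot> Z) X Y W) p =
        ((\<lambda>q. 3 * ?e q ^ 3) \<odot> (vderiv A X ?e \<odot> curvature A D Y Z W +
          vderiv A Y ?e \<odot> curvature A D Z X W + vderiv A Z ?e \<odot> curvature A D X Y W)) p"
      by simp
  qed
qed

end
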